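(* Let $f$ be a continuous probability density on $(0,1)$ such that $$\lim_{N\to\infty}\ \sum_{\substack{\ell=-\infty\\ \ell\neq 0}}^{\infty}\ \prod_{m=1}^{N}\mathcal{M}_h\!\left(1-\frac{2\pi i\ell}{\log 10}\right)=0$$ holds both for $h(x)=f(x)$ and for $h(x)=f(1-x)$. Let $L>0$. For $N\ge 1$, choose cut proportions $p_1,p_2,\dots,p_{2^N-1}$ independently from $(0,1)$ according to the density $f$, and let $X_1,\dots,X_{2^N}$ be the lengths of the $2^N$ pieces obtained after $N$ levels of the unrestricted decomposition of a stick of length $L$, i.e. $$X_1=Lp_1p_2p_4\cdots p_{2^{N-2}}p_{2^{N-1}},\quad X_2=Lp_1p_2p_4\cdots p_{2^{N-2}}(1-p_{2^{N-1}}),\ \dots,$$ $$X_{2^N-1}=L(1-p_1)(1-p_3)\cdots(1-p_{2^{N-1}-1})\,p_{2^N-1},\quad X_{2^N}=L(1-p_1)(1-p_3)\cdots(1-p_{2^{N-1}-1})(1-p_{2^N-1}).$$ For $s\in[1,10)$ let $$P_N(s)=\frac{1}{2^N}\sum_{i=1}^{2^N}\varphi_s(X_i).$$ Then for every $s\in[1,10)$: (1) $\lim_{N\to\infty}\mathbb{E}[P_N(s)]=\log_{10}s$; (2) $\lim_{N\to\infty}\mathrm{Var}(P_N(s))=0$. Thus, as $N\to\infty$, the significands of the resulting stick lengths converge in distribution to Benford's Law.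
   Context: Every $x>0$ is written uniquely as $x=S_{10}(x)\cdot 10^{k}$ with $k\in\mathbb{Z}$ and significand $S_{10}(x)\in[1,10)$. For $s\in[1,10)$, $\varphi_s(x)=1$ if $S_{10}(x)\le s$ and $\varphi_s(x)=0$ otherwise. The Mellin transform of a function $h$ on $[0,\infty)$ is $\mathcal{M}_h(s)=\int_0^\infty h(x)x^{s}\,\frac{dx}{x}$; densities on $(0,1)$ are extended by $0$. Unrestricted decomposition: the stick of length $L$ is cut at proportion $p_1$ into pieces of lengths $Lp_1$ and $L(1-p_1)$; these are cut at proportions $p_2$ and $p_3$ respectively, and so on. Equivalently, label the internal nodes of the complete binary tree of depth $N$ by $1,\dots,2^N-1$, where node $k$ has left child $2k$ and right child $2k+1$. Each of the $2^N$ pieces corresponds to a root-to-leaf path, and its length is $L$ times the product over the $N$ nodes $k$ on the path of $p_k$ (if the path goes left at $k$) or $1-p_k$ (if it goes right at $k$). "Converge in distribution to Benford's Law" means that (1) and (2) hold for all $s\in[1,10)$. *)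

theory Defs
  imports "HOL-Probability.Probability"
begin

definition significand10 :: "real \<Rightarrow> real" where
  "significand10 x = (THE t. 1 \<le> t \<and> t < 10 \<and> (\<exists>k::int. x = t * 10 powi k))"

lemma ex1_significand10:
  fixes x :: real
  assumes "x > 0"
  shows "\<exists>!t. 1 \<le> t \<and> t < 10 \<and> (\<exists>k::int. x = t * 10 powi k)"
proof -
  have pow: "(10::real) powi k = 10 powr real_of_int k" for k
    by (simp add: powr_real_of_int')
  have key: "k = \<lfloor>log 10 x\<rfloor>" if "1 \<le> t" "t < 10" "x = t * 10 powi k" for t k
  proof -
    have "log 10 x = log 10 t + real_of_int k"
      using that by (simp add: pow log_mult)
    moreover have "0 \<le> log 10 t" "log 10 t < 1"
      using that by auto
    ultimately show ?thesis
      by linarith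
  qed
  show ?thesis
  proof (rule ex1I)
    let ?t = "x / 10 powi \<lfloor>log 10 x\<rfloor>"
    have x: "x = 10 powr log 10 x"
      using assms by simp
    have "?t = 10 powr (log 10 x - real_of_int \<lfloor>log 10 x\<rfloor>)"
      using assms by (simp add: pow powr_diff)
    moreover have "0 \<le> log 10 x - real_of_int \<lfloor>log 10 x\<rfloor>"
      "log 10 x - real_of_int \<lfloor>log 10 x\<rfloor> < 1"
      by linarith+
    ultimately have "1 \<le> ?t" "?t < 10"
      using powr_less_mono[of "log 10 x - real_of_int \<lfloor>log 10 x\<rfloor>" 1 10]
      by (auto simp: ge_one_powr_ge_zero)
    then show "1 \<le> ?t \<and> ?t < 10 \<and> (\<exists>k::int. x = ?t * 10 powi k)"
      by (auto intro!: exI[of _ "\<lfloor>log 10 x\<rfloor>"])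
  next
    fix t :: real
    assume "1 \<le> t \<and> t < 10 \<and> (\<exists>k::int. x = t * 10 powi k)"
    then show "t = x / 10 powi \<lfloor>log 10 x\<rfloor>"
      using key by auto
  qed
qed

definition phi :: "real \<Rightarrow> real \<Rightarrow> real" where
  "phi s x = (if significand10 x \<le> s then 1 else 0)"

definition mellin :: "(real \<Rightarrow> real) \<Rightarrow> complex \<Rightarrow> complex" where
  "mellin h s =
     (LINT x:{0<..}|lborel. complex_of_real (h x) * complex_of_real x powr s / complex_of_real x)"

text \<open>
  The sum over all nonzero integers is read as the limit of its symmetric partial sums; this
  limit exists, with the same value, whenever the bilateral series converges in any stronger
  sense. As only the limit in \<open>N\<close> matters, convergence is asked for large \<open>N\<close> only.
\<close>

definition mellin_condition :: "(real \<Rightarrow> real) \<Rightarrow> bool" where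
  "mellin_condition h \<longleftrightarrow>
     (\<exists>S :: nat \<Rightarrow> complex.
        (\<forall>\<^sub>F N in sequentially.
           (\<lambda>K::nat. \<Sum>l\<in>{- int K..int K} - {0}. \<Prod>m=1..N.
              mellin h (1 - 2 * complex_of_real pi * \<i> * of_int l / complex_of_real (ln 10)))
           \<longlonglongrightarrow> S N) \<and>
        S \<longlonglongrightarrow> 0)"

text \<open>
  Length of the stick arriving at node \<open>k \<ge> 1\<close> of the infinite binary tree whose node \<open>k\<close> has
  children \<open>2 * k\<close> and \<open>2 * k + 1\<close>; node \<open>k\<close> cuts its stick at proportion \<open>p k\<close>. The index \<open>0\<close>
  is not a node.
\<close>

fun stick_length :: "real \<Rightarrow> (nat \<Rightarrow> real) \<Rightarrow> nat \<Rightarrow> real" where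
  "stick_length L p k =
     (if k \<le> 1 then L
      else stick_length L p (k div 2) * (if even k then p (k div 2) else 1 - p (k div 2)))"

declare stick_length.simps [simp del]

lemma stick_length_root: "stick_length L p 1 = L"
  by (simp add: stick_length.simps)

lemma stick_length_left: "k \<ge> 1 \<Longrightarrow> stick_length L p (2 * k) = stick_length L p k * p k"
  by (subst stick_length.simps) simp

lemma stick_length_right:
  "k \<ge> 1 \<Longrightarrow> stick_length L p (2 * k + 1) = stick_length L p k * (1 - p k)"
  by (subst stick_length.simps) simp

text \<open>
  After \<open>N\<close> levels the pieces are the sticks at the nodes \<open>2 ^ N, \<dots>, 2 ^ (N + 1) - 1\<close>, listed
  from left to right as \<open>i = 1, \<dots>, 2 ^ N\<close>.
\<close>

definition piece :: "real \<Rightarrow> (nat \<Rightarrow> real) \<Rightarrow> nat \<Rightarrow> nat \<Rightarrow> real" where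
  "piece L p N i = stick_length L p (2 ^ N + i - 1)"

definition sig_fraction :: "real \<Rightarrow> (nat \<Rightarrow> real) \<Rightarrow> nat \<Rightarrow> real \<Rightarrow> real" where
  "sig_fraction L p N s = 1 / 2 ^ N * (\<Sum>i=1..2 ^ N. phi s (piece L p N i))"

end

(*
  For l \<noteq> 0 put e(x) = exp (2 pi i l log_10 x), and let W(n) be the average of e over the 2^n sticks
  of level n. As e is multiplicative, W(n+1) - c W(n), where c = E[(e(p) + e(1 - p)) / 2], is
  2^(-n) times a sum of 2^n bounded increments. They are pairwise orthogonal because distinct sticks
  of one level are cut independently, hence E|W(n+1)| \<le> |c| E|W(n)| + 2 * 2^(-n/2). Since p has no
  atoms, e(p) is not almost surely constant, so |c| < 1 and E|W(n)| \<longlongrightarrow> 0. By Stone-Weierstrass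
  the average of every continuous function of log_10 X_i mod 1 tends in L^1 to its integral, and
  squeezing phi between such functions gives E|P_N(s) - log_10 s| \<longlongrightarrow> 0. As P_N(s) and log_10 s lie in
  [0,1], this controls both the mean and the variance.
*)

theory Submission
  imports Defs
begin

section \<open>Trigonometric polynomials on the circle\<close>

text \<open>The obstacle is dependence: two sticks of one level share the cuts at all their common
  ancestors, so their lengths are not independent samples. Moving up one level at a time avoids
  this, since only the fresh cuts at the nodes of level n enter the step. Averaging the two children
  of a node puts p and 1 - p of the same cut into one factor, which is why c is a mean of two terms;
  the first term alone makes |c| < 1 strict. By Pythagoras the 2^n increments, each of norm at most
  2, have a sum of L^2 norm at most 2 * 2^(n/2); division by 2^n yields the noise term. The
  probability space may change with N, so no single process has levels tending to infinity: the
  recursion runs over n <= N inside the N-th space, and its bound depends on l and N only.\<close>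

definition circle_char :: "int \<Rightarrow> real \<Rightarrow> complex" where
  "circle_char l t = cis (2 * pi * of_int l * t)"

lemma norm_circle_char [simp]: "norm (circle_char l t) = 1"
  by (simp add: circle_char_def)

lemma circle_char_0 [simp]: "circle_char 0 t = 1"
  by (simp add: circle_char_def)

lemma circle_char_add: "circle_char l (t + u) = circle_char l t * circle_char l u"
  by (simp add: circle_char_def cis_mult algebra_simps)

lemma circle_char_mult: "circle_char l t * circle_char m t = circle_char (l + m) t"
  by (simp add: circle_char_def cis_mult algebra_simps)

lemma circle_char_of_int [simp]: "circle_char l (of_int k) = 1"
  using cis_multiple_2pi[of "of_int (l * k)"] by (simp add: circle_char_def mult.assoc)

lemma continuous_on_circle_char [continuous_intros]:
  "continuous_on S g \<Longrightarrow> continuous_on S (\<lambda>x. circle_char l (g x))"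
  unfolding circle_char_def by (intro continuous_intros)

lemma measurable_circle_char [measurable]: "circle_char l \<in> borel_measurable borel"
  by (intro borel_measurable_continuous_onI continuous_intros)

lemma circle_char_1_eq_iff: "circle_char 1 t = circle_char 1 u \<longleftrightarrow> t - u \<in> \<int>"
proof
  assume "circle_char 1 t = circle_char 1 u"
  then have "cos (2 * pi * t) = cos (2 * pi * u)" "sin (2 * pi * t) = sin (2 * pi * u)"
    by (auto simp: circle_char_def complex_eq_iff)
  then obtain n :: int where "2 * pi * t = 2 * pi * u + 2 * pi * n"
    using sin_cos_eq_iff[of "2 * pi * t" "2 * pi * u"] by auto
  then have "2 * pi * (t - u) = 2 * pi * n"
    by (simp add: algebra_simps)
  then have "t - u = n"
    by simp
  then show "t - u \<in> \<int>"
    by simp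
next
  assume "t - u \<in> \<int>"
  then obtain n where "t = u + of_int n"
    by (metis Ints_cases add_diff_cancel_left' diff_add_cancel add.commute)
  then show "circle_char 1 t = circle_char 1 u"
    by (simp add: circle_char_add)
qed

lemma circle_char_eq: "circle_char l t = circle_char 1 (of_int l * t)"
  by (simp add: circle_char_def mult.assoc)

lemma integral_circle_char:
  "integral {0..1} (circle_char l) = (if l = 0 then 1 else 0)"
proof (cases "l = 0")
  case False
  define c where "c = 2 * pi * of_int l"
  have c: "c \<noteq> 0"
    using False by (simp add: c_def)
  have d: "((\<lambda>t. cis (c * t) / (\<i> * c)) has_vector_derivative circle_char l t) (at t within {0..1})" for t
    unfolding circle_char_def c_def[symmetric] has_vector_derivative_def
    using c by (auto intro!: derivative_eq_intros simp: scaleR_conv_of_real field_simps)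
  have "(circle_char l has_integral (cis (c * 1) / (\<i> * c) - cis (c * 0) / (\<i> * c))) {0..1}"
    by (intro fundamental_theorem_of_calculus d) auto
  moreover have "cis (c * 1) = 1"
    using circle_char_of_int[of l 1] by (simp add: circle_char_def c_def)
  ultimately show ?thesis
    using False by (simp add: integral_unique)
qed (simp add: fun_eq_iff cong: integral_cong)

text \<open>A closure rather than explicit finite sums: convergence of \<open>deviation\<close> is
  later proved by rule induction, with one estimate for each generating rule.\<close>

inductive trig_poly :: "(real \<Rightarrow> complex) \<Rightarrow> bool" where
  char: "trig_poly (circle_char l)"
| add: "trig_poly g \<Longrightarrow> trig_poly h \<Longrightarrow> trig_poly (\<lambda>t. g t + h t)"
| scale: "trig_poly g \<Longrightarrow> trig_poly (\<lambda>t. c * g t)"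

lemma trig_poly_const: "trig_poly (\<lambda>t. c)"
  using trig_poly.scale[OF trig_poly.char[of 0], of c] by simp

lemma trig_poly_mult:
  assumes "trig_poly g" "trig_poly h"
  shows "trig_poly (\<lambda>t. g t * h t)"
  using assms(1)
proof induction
  case (char l)
  show ?case
    using assms(2)
  proof induction
    case (char m)
    show ?case
      using trig_poly.char[of "l + m"] by (simp add: circle_char_mult)
  next
    case (add g h)
    then show ?case
      using trig_poly.add by (simp add: distrib_left)
  next
    case (scale g c)
    then show ?case
      using trig_poly.scale[OF scale(2), of c] by (simp add: mult.left_commute)
  qed
next
  case (add g1 g2)
  then show ?case
    using trig_poly.add by (simp add: distrib_right)
next
  case (scale g c)
  then show ?case
    using trig_poly.scale[OF scale(2), of c] by (simp add: mult.assoc)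
qed

lemma trig_poly_continuous: "trig_poly h \<Longrightarrow> continuous_on S h"
  by (induction rule: trig_poly.induct) (auto intro!: continuous_intros continuous_on_circle_char[where g = "\<lambda>x. x", simplified])

lemma trig_poly_bounded: "trig_poly h \<Longrightarrow> \<exists>B. \<forall>t. norm (h t) \<le> B"
proof (induction rule: trig_poly.induct)
  case (char l)
  then show ?case
    by (intro exI[of _ 1]) simp
next
  case (add g h)
  then obtain B1 B2 where "\<And>t. norm (g t) \<le> B1" "\<And>t. norm (h t) \<le> B2"
    by blast
  then show ?case
    by (intro exI[of _ "B1 + B2"] allI norm_triangle_mono)
next
  case (scale g c)
  then obtain B where "\<And>t. norm (g t) \<le> B"
    by blast
  then show ?case
    by (intro exI[of _ "norm c * B"]) (simp add: norm_mult mult_left_mono)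
qed

text \<open>Stone-Weierstrass is applied to real functions on the unit circle, where periodicity is
  built in. The algebra \<open>R\<close> consists of those whose pullback along
  \<open>circle_char 1\<close> is a trigonometric polynomial; \<open>Re\<close> and
  \<open>Im\<close> belong to it and separate points.\<close>

lemma trig_poly_dense:
  fixes g :: "complex \<Rightarrow> real"
  assumes g: "continuous_on (sphere 0 1) g" and e: "e > 0"
  obtains h where "trig_poly h" "\<And>t. norm (of_real (g (circle_char 1 t)) - h t) < e"
proof -
  define R where "R = {g. continuous_on (sphere 0 1) g \<and>
    trig_poly (\<lambda>t. complex_of_real (g (circle_char 1 t)))}"
  have "circle_char 1 = (\<lambda>t. cis (2 * pi * t))" "circle_char (-1) = (\<lambda>t. cis (- (2 * pi * t)))"
    by (auto simp: circle_char_def)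
  note chars = trig_poly.char[of 1, unfolded this] trig_poly.char[of "-1", unfolded this]
  \<comment> \<open>Euler's formulas for cosine and sine. The difference is written as a sum with a
    multiple by -1, because \<open>trig_poly\<close> has rules for sums and scalings only.\<close>
  have "trig_poly (\<lambda>t. 1/2 * (cis (2 * pi * t) + cis (- (2 * pi * t))))"
    "trig_poly (\<lambda>t. - \<i>/2 * (cis (2 * pi * t) + (- 1) * cis (- (2 * pi * t))))"
    by (intro trig_poly.scale trig_poly.add chars)+
  moreover have "(\<lambda>t. 1/2 * (cis (2 * pi * t) + cis (- (2 * pi * t)))) =
      (\<lambda>t. complex_of_real (Re (circle_char 1 t)))"
    "(\<lambda>t. - \<i>/2 * (cis (2 * pi * t) + (- 1) * cis (- (2 * pi * t)))) =
      (\<lambda>t. complex_of_real (Im (circle_char 1 t)))"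
    by (auto simp: circle_char_def complex_eq_iff)
  ultimately have ReIm: "Re \<in> R" "Im \<in> R"
    by (auto simp: R_def intro!: continuous_intros)
  interpret function_ring_on R "sphere 0 1"
  proof
    show "continuous_on (sphere 0 1) f" if "f \<in> R" for f
      using that by (simp add: R_def)
    show "(\<lambda>x. f x + g x) \<in> R" if "f \<in> R" "g \<in> R" for f g
      using that by (auto simp: R_def intro!: continuous_intros trig_poly.add)
    show "(\<lambda>x. f x * g x) \<in> R" if "f \<in> R" "g \<in> R" for f g
      using that by (auto simp: R_def intro!: continuous_intros trig_poly_mult)
    show "(\<lambda>_. c) \<in> R" for c
      by (auto simp: R_def intro!: trig_poly_const)
    show "\<exists>f\<in>R. f x \<noteq> f y" if "x \<noteq> y" for x y
      using that ReIm by (auto simp: complex_eq_iff)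
  qed auto
  obtain g' where g': "g' \<in> R" "\<And>x. x \<in> sphere 0 1 \<Longrightarrow> \<bar>g x - g' x\<bar> < e"
    using Stone_Weierstrass_basic[OF g e] by blast
  show thesis
  proof
    show "trig_poly (\<lambda>t. complex_of_real (g' (circle_char 1 t)))"
      using g' by (simp add: R_def)
    show "norm (of_real (g (circle_char 1 t)) - complex_of_real (g' (circle_char 1 t))) < e" for t
      using g'(2)[of "circle_char 1 t"]
      by (simp flip: of_real_diff)
  qed
qed

text \<open>The tent functions \<open>g n\<close> fall off linearly with the distance from the
  closed arc \<open>C\<close>, and they tend pointwise to its indicator. Dominated convergence
  brings their integrals down to the arc length, so a large \<open>n\<close> does.\<close>

lemma arc_majorant:
  assumes ab: "0 \<le> a" "a \<le> b" "b \<le> 1" and e: "e > 0"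
  obtains g :: "complex \<Rightarrow> real"
  where "continuous_on UNIV g" "\<And>z. 0 \<le> g z"
    "\<And>t. t \<in> {a..b} \<Longrightarrow> g (circle_char 1 t) = 1"
    "integral {0..1} (\<lambda>t. g (circle_char 1 t)) \<le> b - a + e"
proof -
  define C where "C = circle_char 1 ` {a..b}"
  have C: "compact C" "C \<noteq> {}"
    unfolding C_def using ab by (auto intro!: compact_continuous_image continuous_intros)
  define g :: "nat \<Rightarrow> complex \<Rightarrow> real" where "g n z = max 0 (1 - real n * infdist z C)" for n z
  have cont: "continuous_on S (g n)" for n S
    unfolding g_def by (intro continuous_intros)
  have cont': "continuous_on {0..1} (\<lambda>t. g n (circle_char 1 t))" for n
    by (rule continuous_on_compose2[OF cont[of UNIV]]) (auto intro!: continuous_intros)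
  define D where "D t = (if circle_char 1 t \<in> C then 1 else 0 :: real)" for t
  have lim: "(\<lambda>n. g n (circle_char 1 t)) \<longlonglongrightarrow> D t" for t
  proof (cases "circle_char 1 t \<in> C")
    case True
    then show ?thesis
      by (simp add: g_def D_def)
  next
    case False
    then have "infdist (circle_char 1 t) C > 0"
      using C by (simp add: infdist_pos_not_in_closed compact_imp_closed)
    then have "\<forall>\<^sub>F n in sequentially. 1 / infdist (circle_char 1 t) C \<le> real n"
      using filterlim_real_sequentially by (simp add: filterlim_at_top)
    then have "\<forall>\<^sub>F n in sequentially. g n (circle_char 1 t) = 0"
    proof eventually_elim
      case (elim n)
      then have "1 \<le> real n * infdist (circle_char 1 t) C"
        using \<open>infdist (circle_char 1 t) C > 0\<close> by (simp add: pos_divide_le_eq)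
      then show ?case
        by (simp add: g_def)
    qed
    then show ?thesis
      using False by (simp add: D_def tendsto_eventually)
  qed
  have "(\<lambda>n. integral {0..1} (\<lambda>t. g n (circle_char 1 t))) \<longlonglongrightarrow> integral {0..1} D"
  proof (rule dominated_convergence(2))
    show "(\<lambda>t. g k (circle_char 1 t)) integrable_on {0..1}" for k
      by (rule integrable_continuous_real[OF cont'])
    show "(\<lambda>t::real. 1::real) integrable_on {0..1}"
      by (rule integrable_const_ivl)
    show "norm (g k (circle_char 1 t)) \<le> 1" for k t
      by (simp add: g_def infdist_nonneg)
    show "(\<lambda>n. g n (circle_char 1 t)) \<longlonglongrightarrow> D t" for t
      by (rule lim)
  qed
  moreover have "integral {0..1} D = b - a"
  proof -
    have "((\<lambda>t. if t \<in> {a..b} then 1 else 0 :: real) has_integral (b - a)) {0..1}"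
      using has_integral_const_real[of "1::real" a b] ab
      by (subst has_integral_restrict) simp_all
    \<comment> \<open>The endpoints 0 and 1 are left out because they are the same point of the
      circle: if a = 0, then t = 1 also lands in \<open>C\<close>. Strictly between them, t and any
      u in [a,b] differ by less than 1, so congruence modulo 1 forces equality.\<close>
    moreover have "D t = (if t \<in> {a..b} then 1 else 0)" if "t \<in> {0..1} - {0, 1}" for t
    proof -
      have "t \<in> {a..b}" if u: "u \<in> {a..b}" "circle_char 1 t = circle_char 1 u" for u
      proof -
        obtain n :: int where n: "t - u = n"
          using u circle_char_1_eq_iff Ints_cases by metis
        have "- 1 < t - u" "t - u < 1"
          using u \<open>t \<in> _\<close> ab by auto
        then have "n = 0"
          using n by linarith
        then show ?thesis
          using u n by simp
      qed
      then show ?thesis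
        by (auto simp: D_def C_def)
    qed
    ultimately have "(D has_integral (b - a)) {0..1}"
      by - (rule has_integral_spike_finite[of "{0, 1}"], simp_all only: finite.intros)
    then show ?thesis
      by (rule integral_unique)
  qed
  ultimately have "\<forall>\<^sub>F n in sequentially. integral {0..1} (\<lambda>t. g n (circle_char 1 t)) < b - a + e"
    using e by (auto intro: order_tendstoD)
  then obtain n where n: "integral {0..1} (\<lambda>t. g n (circle_char 1 t)) < b - a + e"
    using eventually_happens'[OF sequentially_bot] by blast
  show thesis
  proof (rule that[of "g n"])
    show "g n (circle_char 1 t) = 1" if "t \<in> {a..b}" for t
      using that by (simp add: g_def C_def)
  qed (use cont n in \<open>simp_all add: g_def\<close>)
qed

section \<open>Significands and logarithms modulo one\<close>

lemma significand10_decomp: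
  assumes "x > 0"
  obtains k :: int where "1 \<le> significand10 x" "significand10 x < 10"
    "x = significand10 x * 10 powi k" "log 10 x = log 10 (significand10 x) + k"
proof -
  obtain k :: int where u: "1 \<le> significand10 x" "significand10 x < 10" "x = significand10 x * 10 powi k"
    using theI'[OF ex1_significand10[OF assms]] unfolding significand10_def by blast
  have "log 10 x = log 10 (significand10 x * 10 powr real_of_int k)"
    using u(3) by (simp add: powr_real_of_int')
  also have "\<dots> = log 10 (significand10 x) + k"
    using u(1) by (simp add: log_mult)
  finally show thesis
    using u that by blast
qed

text \<open>Here \<open>t\<close> is the fractional part of log 10 x, so \<open>phi\<close> becomes
  the indicator of an initial arc modulo 1. The pair \<open>t\<close>, \<open>k\<close> serves all
  \<open>s\<close> at once.\<close>

lemma log10_phi: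
  assumes "x > 0"
  obtains t :: real and k :: int where "log 10 x = t + k" "0 \<le> t" "t < 1"
    "\<And>s. 1 \<le> s \<Longrightarrow> phi s x = (if t \<le> log 10 s then 1 else 0)"
proof -
  obtain k :: int where u: "1 \<le> significand10 x" "significand10 x < 10"
    "log 10 x = log 10 (significand10 x) + k"
    using significand10_decomp[OF assms] by metis
  show thesis
  proof (rule that[of "log 10 (significand10 x)" k])
    show "phi s x = (if log 10 (significand10 x) \<le> log 10 s then 1 else 0)" if "1 \<le> s" for s
      using u that by (simp add: phi_def)
  qed (use u in auto)
qed

text \<open>For \<open>x \<le> 0\<close> the description defining the significand is empty, hence the same junk value for all such \<open>x\<close>.\<close>

lemma significand10_eq:
  "significand10 x = (if x > 0 then x / 10 powi \<lfloor>log 10 x\<rfloor> else (THE t. False))"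
proof (cases "x > 0")
  case True
  obtain k :: int where u: "1 \<le> significand10 x" "significand10 x < 10"
    "x = significand10 x * 10 powi k" "log 10 x = log 10 (significand10 x) + k"
    using significand10_decomp[OF True] .
  have "0 \<le> log 10 (significand10 x)" "log 10 (significand10 x) < 1"
    using u by auto
  with u(4) have "\<lfloor>log 10 x\<rfloor> = k"
    by linarith
  then show ?thesis
    using True u(3) by (simp add: field_simps)
next
  case False
  have "0 < t * 10 powi k" if "1 \<le> t" for t :: real and k :: int
    using that by simp
  then have "(\<lambda>t. 1 \<le> t \<and> t < 10 \<and> (\<exists>k::int. x = t * 10 powi k)) = (\<lambda>t. False)"
    using False by blast
  then show ?thesis
    using False by (simp only: significand10_def if_False)
qed

text \<open>The description operator in \<open>significand10\<close> gives no handle on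
  measurability; the closed form with the floor does, its value for x <= 0 being a constant.\<close>

lemma measurable_phi [measurable]: "phi s \<in> borel_measurable borel"
proof -
  have "(\<lambda>x. if x > 0 then x / 10 powr real_of_int \<lfloor>log 10 x\<rfloor> else (THE t. False)) \<in> borel_measurable borel"
    by measurable
  then have [measurable]: "significand10 \<in> borel_measurable borel"
    by (simp add: significand10_eq[abs_def] powr_real_of_int')
  show ?thesis
    unfolding phi_def[abs_def] by measurable
qed

text \<open>The character is blind to the integer part of log 10 x, so only the fractional part has
  to be located in the arc.\<close>

lemma phi_le_majorant:
  assumes g: "\<And>z. 0 \<le> g z" "\<And>t. t \<in> {0..log 10 s} \<Longrightarrow> g (circle_char 1 t) = 1"
    and "x > 0" "1 \<le> s"
  shows "phi s x \<le> g (circle_char 1 (log 10 x))"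
  by (rule log10_phi[OF \<open>x > 0\<close>]) (use assms in \<open>auto simp: circle_char_add\<close>)

text \<open>An upper bound for \<open>1 - phi s x\<close> is a lower bound for
  \<open>phi s x\<close>, so majorants suffice on both sides. The closed arc contains the boundary
  point log 10 s as well, which is harmless since \<open>g\<close> is nonnegative.\<close>

lemma one_minus_phi_le_majorant:
  assumes g: "\<And>z. 0 \<le> g z" "\<And>t. t \<in> {log 10 s..1} \<Longrightarrow> g (circle_char 1 t) = 1"
    and "x > 0" "1 \<le> s"
  shows "1 - phi s x \<le> g (circle_char 1 (log 10 x))"
  by (rule log10_phi[OF \<open>x > 0\<close>]) (use assms in \<open>auto simp: circle_char_add\<close>)

section \<open>Sticks and level averages\<close>

text \<open>The length at \<open>k\<close> depends only on the cuts at proper ancestors, whose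
  labels are at most \<open>k div 2\<close>. This crude range is good enough: for a node of level n
  it stays below 2^n, hence within earlier levels.\<close>

lemma stick_length_cong:
  "(\<And>j. j \<in> {1..k div 2} \<Longrightarrow> p j = q j) \<Longrightarrow> stick_length L p k = stick_length L q k"
proof (induction k rule: less_induct)
  case (less k)
  show ?case
  proof (cases "k \<le> 1")
    case False
    have "k div 2 \<in> {1..k div 2}"
      using False by auto
    moreover have "stick_length L p (k div 2) = stick_length L q (k div 2)"
      using False by (intro less) auto
    ultimately show ?thesis
      using False less(2) by (subst (1 2) stick_length.simps) simp
  qed (simp add: stick_length.simps)
qed

text \<open>The index set is arbitrary because the independence argument needs the length as a
  function of all cuts except one.\<close>

lemma measurable_stick_length:
  "{1..k div 2} \<subseteq> I \<Longrightarrow> (\<lambda>p. stick_length L p k) \<in> borel_measurable (PiM I (\<lambda>_. borel))"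
proof (induction k rule: less_induct)
  case (less k)
  show ?case
  proof (cases "k \<le> 1")
    case False
    have [measurable]: "(\<lambda>p. p (k div 2)) \<in> borel_measurable (PiM I (\<lambda>_. borel :: real measure))"
      using False less(2) by (intro measurable_component_singleton) auto
    have [measurable]: "(\<lambda>p. stick_length L p (k div 2)) \<in> borel_measurable (PiM I (\<lambda>_. borel))"
      using False less(2) by (intro less(1) order_trans[OF _ less(2)]) auto
    show ?thesis
      using False by (subst stick_length.simps) simp
  qed (simp add: stick_length.simps)
qed

lemma stick_length_pos:
  "L > 0 \<Longrightarrow> (\<And>j. j \<in> {1..k div 2} \<Longrightarrow> 0 < p j \<and> p j < 1) \<Longrightarrow> stick_length L p k > 0"
proof (induction k rule: less_induct)
  case (less k)
  show ?case
  proof (cases "k \<le> 1")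
    case False
    have "k div 2 \<in> {1..k div 2}"
      using False by auto
    moreover have "stick_length L p (k div 2) > 0"
      using False less(2,3) by (intro less(1)) auto
    ultimately show ?thesis
      using False less(3)[of "k div 2"] by (subst stick_length.simps) auto
  qed (use less in \<open>simp add: stick_length.simps\<close>)
qed

lemma sum_double_interval:
  fixes h :: "nat \<Rightarrow> 'a::comm_monoid_add"
  assumes "a \<le> b"
  shows "sum h {2 * a..<2 * b} = (\<Sum>k\<in>{a..<b}. h (2 * k) + h (2 * k + 1))"
  using assms by (induction b rule: dec_induct) (auto simp: add.assoc)

text \<open>The target type is left open: complex characters and real majorants are both averaged.
  The functions act on log 10 of the length, so that multiplying lengths becomes
  translation.\<close>

definition level_avg :: "real \<Rightarrow> (nat \<Rightarrow> real) \<Rightarrow> nat \<Rightarrow> (real \<Rightarrow> 'b::real_vector) \<Rightarrow> 'b" where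
  "level_avg L p n h = (1 / 2 ^ n) *\<^sub>R (\<Sum>k\<in>{2 ^ n..<2 ^ Suc n}. h (log 10 (stick_length L p k)))"

lemma level_avg_const: "level_avg L p n (\<lambda>_. c) = c"
  by (simp add: level_avg_def scaleR_conv_of_real sum_constant_scaleR)

lemma level_avg_add: "level_avg L p n (\<lambda>t. g t + h t) = level_avg L p n g + level_avg L p n h"
  by (simp add: level_avg_def sum.distrib scaleR_right_distrib)

lemma level_avg_diff: "level_avg L p n (\<lambda>t. g t - h t) = level_avg L p n g - level_avg L p n h"
  by (simp add: level_avg_def sum_subtractf scaleR_right_diff_distrib)

lemma level_avg_mult:
  fixes c :: "'b::real_algebra"
  shows "level_avg L p n (\<lambda>t. c * h t) = c * level_avg L p n h"
  by (simp add: level_avg_def sum_distrib_left)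

lemma level_avg_of_real:
  "level_avg L p n (\<lambda>t. of_real (g t)) = (of_real (level_avg L p n g) :: 'b::real_algebra_1)"
  by (simp only: level_avg_def real_scaleR_def of_real_mult of_real_sum scaleR_conv_of_real[where 'a = 'b])

lemma norm_level_avg_le:
  fixes h :: "real \<Rightarrow> 'b::real_normed_vector"
  assumes "\<And>t. norm (h t) \<le> B"
  shows "norm (level_avg L p n h) \<le> B"
proof -
  have "norm (\<Sum>k\<in>{2 ^ n..<2 ^ Suc n}. h (log 10 (stick_length L p k))) \<le> (\<Sum>k\<in>{2 ^ n..<2 ^ Suc n :: nat}. B)"
    by (intro sum_norm_le assms)
  then show ?thesis
    by (simp add: level_avg_def field_simps)
qed

lemma sig_fraction_altdef:
  "sig_fraction L p N s = (1 / 2 ^ N) * (\<Sum>k\<in>{2 ^ N..<2 ^ Suc N}. phi s (stick_length L p k))"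
proof -
  have "(\<Sum>i=1..2 ^ N. phi s (piece L p N i)) = (\<Sum>k\<in>{2 ^ N..<2 ^ Suc N}. phi s (stick_length L p k))"
    by (rule sum.reindex_bij_witness[of _ "\<lambda>k. k + 1 - 2 ^ N" "\<lambda>i. 2 ^ N + i - 1"])
      (auto simp: piece_def)
  then show ?thesis
    by (simp add: sig_fraction_def)
qed

text \<open>The factor by which one cut at proportion \<open>x\<close> changes a character, averaged
  over the two children. Its mean is the constant c of the overview.\<close>

definition split_char :: "int \<Rightarrow> real \<Rightarrow> complex" where
  "split_char l x = (circle_char l (log 10 x) + circle_char l (log 10 (1 - x))) / 2"

lemma measurable_split_char [measurable]: "split_char l \<in> borel_measurable borel"
  unfolding split_char_def by measurable

lemma norm_split_char_le: "norm (split_char l x) \<le> 1"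
  using norm_triangle_ineq[of "circle_char l (log 10 x)" "circle_char l (log 10 (1 - x))"]
  by (simp add: split_char_def norm_divide)

text \<open>Node \<open>k\<close> has the children \<open>2 * k\<close> and
  \<open>2 * k + 1\<close>, and a character of a child's log-length is the parent's value times the
  character of log p or log (1 - p). The cuts must lie in (0,1) for the logarithm of the product to
  split.\<close>

lemma level_avg_Suc:
  assumes "L > 0" "\<And>j. j \<in> {1..<2 ^ Suc n} \<Longrightarrow> 0 < p j \<and> p j < 1"
  shows "level_avg L p (Suc n) (circle_char l) =
    (1 / 2 ^ n) *\<^sub>R (\<Sum>k\<in>{2 ^ n..<2 ^ Suc n}. circle_char l (log 10 (stick_length L p k)) * split_char l (p k))"
proof -
  have "circle_char l (log 10 (stick_length L p (2 * k))) + circle_char l (log 10 (stick_length L p (2 * k + 1))) =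
      2 * (circle_char l (log 10 (stick_length L p k)) * split_char l (p k))"
    if "k \<in> {2 ^ n..<2 ^ Suc n}" for k
  proof -
    have k: "k \<ge> 1" "k < 2 ^ Suc n"
      using that order_trans[OF one_le_power[of "2::nat" n]] by auto
    have "stick_length L p k > 0"
      using assms k by (intro stick_length_pos) auto
    then show ?thesis
      using assms(2)[of k] k
      by (simp add: stick_length_left stick_length_right[simplified] log_mult split_char_def
          circle_char_add distrib_left)
  qed
  then have "(\<Sum>k\<in>{2 * 2 ^ n..<2 * 2 ^ Suc n}. circle_char l (log 10 (stick_length L p k))) =
      (\<Sum>k\<in>{2 ^ n..<2 ^ Suc n}. 2 * (circle_char l (log 10 (stick_length L p k)) * split_char l (p k)))"
    by (subst sum_double_interval) (auto intro!: sum.cong)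
  then show ?thesis
    by (simp add: level_avg_def sum_distrib_left[symmetric] scaleR_conv_of_real)
qed

section \<open>Decay of the character averages\<close>

lemma measurable_cnj [measurable]: "cnj \<in> borel_measurable borel"
  by (intro borel_measurable_continuous_onI continuous_intros)

text \<open>Equality case of the triangle inequality: if the mean m had norm 1, then E|Z - m|^2 = 1
  + 1 - 2|m|^2 = 0, so Z would almost surely be the constant m.\<close>

lemma (in prob_space) norm_expectation_less_1:
  fixes Z :: "'a \<Rightarrow> complex"
  assumes [measurable]: "Z \<in> borel_measurable M"
    and Z: "\<And>x. norm (Z x) = 1" and nonconst: "\<And>w. AE x in M. Z x \<noteq> w"
  shows "norm (expectation Z) < 1"
proof (rule ccontr)
  define m where "m = expectation Z"
  have int: "integrable M Z"
    by (rule integrable_const_bound[of _ 1]) (auto simp: Z)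
  assume "\<not> norm (expectation Z) < 1"
  moreover have "norm m \<le> 1"
    unfolding m_def using integral_norm_bound[of M Z] by (simp add: Z prob_space)
  ultimately have m: "norm m = 1"
    by (simp add: m_def)
  have sq: "(norm (Z x - m))\<^sup>2 = 2 - 2 * Re (Z x * cnj m)" for x
  proof -
    have "(norm (Z x - m))\<^sup>2 = (norm (Z x))\<^sup>2 + (norm m)\<^sup>2 - 2 * Re (Z x * cnj m)"
      unfolding cmod_power2 by (simp add: power2_eq_square algebra_simps)
    then show ?thesis
      by (simp add: Z m)
  qed
  then have sq_int: "integrable M (\<lambda>x. (norm (Z x - m))\<^sup>2)"
    using int by (simp add: sq)
  have "expectation (\<lambda>x. (norm (Z x - m))\<^sup>2) = 2 - 2 * Re (m * cnj m)"
    unfolding sq using int by (simp add: prob_space m_def)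
  also have "\<dots> = 0"
    by (simp add: m complex_norm_square[symmetric])
  finally have "AE x in M. (norm (Z x - m))\<^sup>2 = 0"
    by (subst (asm) integral_nonneg_eq_0_iff_AE) (use sq_int in auto)
  with nonconst[of m] have "AE x in M. False"
    by eventually_elim auto
  then show False
    by simp
qed

lemma (in prob_space) square_expectation_le:
  fixes Y :: "'a \<Rightarrow> real"
  assumes "integrable M Y" "integrable M (\<lambda>x. (Y x)\<^sup>2)"
  shows "(expectation Y)\<^sup>2 \<le> expectation (\<lambda>x. (Y x)\<^sup>2)"
  using variance_eq[OF assms] variance_positive[of Y] by linarith

text \<open>Pythagoras: the square expands into a double sum of which only the diagonal survives.
  The computation takes place in the complex numbers and returns to the reals through the
  norm.\<close>

lemma (in prob_space) expectation_norm_sum_orthogonal: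
  fixes a :: "'i \<Rightarrow> 'a \<Rightarrow> complex" and B :: real
  assumes "finite A" and [measurable]: "\<And>k. k \<in> A \<Longrightarrow> a k \<in> borel_measurable M"
    and bound: "\<And>k x. k \<in> A \<Longrightarrow> norm (a k x) \<le> B"
    and orth: "\<And>j k. j \<in> A \<Longrightarrow> k \<in> A \<Longrightarrow> j \<noteq> k \<Longrightarrow> expectation (\<lambda>x. a j x * cnj (a k x)) = 0"
  shows "expectation (\<lambda>x. (norm (\<Sum>k\<in>A. a k x))\<^sup>2) \<le> card A * B\<^sup>2"
proof (cases "A = {}")
  case False
  then obtain k where "k \<in> A"
    by auto
  have "B \<ge> 0"
    using order_trans[OF norm_ge_zero bound[OF \<open>k \<in> A\<close>]] .
  then have prod_bound: "norm (a j x * cnj (a k x)) \<le> B * B" if "j \<in> A" "k \<in> A" for j k x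
    using that by (auto simp: norm_mult intro!: mult_mono bound)
  then have int: "integrable M (\<lambda>x. a j x * cnj (a k x))" if "j \<in> A" "k \<in> A" for j k
    using that by (intro integrable_const_bound[of _ "B * B"]) auto
  have sq: "complex_of_real ((norm (\<Sum>k\<in>A. a k x))\<^sup>2) = (\<Sum>j\<in>A. \<Sum>k\<in>A. a j x * cnj (a k x))" for x
    by (simp only: complex_norm_square cnj_sum sum_product)
  have "complex_of_real (expectation (\<lambda>x. (norm (\<Sum>k\<in>A. a k x))\<^sup>2)) =
      expectation (\<lambda>x. \<Sum>j\<in>A. \<Sum>k\<in>A. a j x * cnj (a k x))"
    unfolding sq[symmetric] by (rule integral_complex_of_real[symmetric])
  also have "\<dots> = (\<Sum>j\<in>A. \<Sum>k\<in>A. expectation (\<lambda>x. a j x * cnj (a k x)))"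
    using int by (simp add: Bochner_Integration.integral_sum Bochner_Integration.integrable_sum)
  also have "\<dots> = (\<Sum>j\<in>A. \<Sum>k\<in>A. if j = k then expectation (\<lambda>x. a j x * cnj (a j x)) else 0)"
    by (intro sum.cong refl) (auto simp: orth)
  also have "\<dots> = (\<Sum>j\<in>A. expectation (\<lambda>x. a j x * cnj (a j x)))"
    using assms(1) by simp
  finally have eq: "complex_of_real (expectation (\<lambda>x. (norm (\<Sum>k\<in>A. a k x))\<^sup>2)) =
      (\<Sum>j\<in>A. expectation (\<lambda>x. a j x * cnj (a j x)))" .
  have "expectation (\<lambda>x. (norm (\<Sum>k\<in>A. a k x))\<^sup>2) \<le>
      norm (complex_of_real (expectation (\<lambda>x. (norm (\<Sum>k\<in>A. a k x))\<^sup>2)))"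
    unfolding norm_of_real by (rule abs_ge_self)
  also have "\<dots> = norm (\<Sum>j\<in>A. expectation (\<lambda>x. a j x * cnj (a j x)))"
    unfolding eq ..
  also have "\<dots> \<le> (\<Sum>j\<in>A. B * B)"
  proof (intro sum_norm_le)
    fix j assume j: "j \<in> A"
    have "norm (expectation (\<lambda>x. a j x * cnj (a j x))) \<le> expectation (\<lambda>x. norm (a j x * cnj (a j x)))"
      by simp
    also have "\<dots> \<le> expectation (\<lambda>x. B * B)"
      using int[OF j j] prod_bound[OF j j] by (intro integral_mono) auto
    finally show "norm (expectation (\<lambda>x. a j x * cnj (a j x))) \<le> B * B"
      by (simp add: prob_space)
  qed
  finally show ?thesis
    by (simp add: power2_eq_square)
qed simp

text \<open>Both the contraction r and the noise rate q are replaced by a common rate \<rho>. The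
  recursion is then resonant, which costs the factor n + 1; the constant 2 / \<rho> is chosen so
  that each step adds exactly the noise 2 * \<rho>^n. The recursion is assumed only below
  \<open>N\<close>, where cuts exist.\<close>

lemma linear_recurrence_bound:
  fixes v :: "nat \<Rightarrow> real"
  assumes "v 0 \<le> 1" "\<And>n. n < N \<Longrightarrow> v (Suc n) \<le> r * v n + 2 * q ^ n" "\<And>n. 0 \<le> v n"
    and "0 \<le> q" "r \<le> \<rho>" "q \<le> \<rho>" "0 < \<rho>" "\<rho> < 1"
  shows "n \<le> N \<Longrightarrow> v n \<le> 2 / \<rho> * (real (Suc n) * \<rho> ^ n)"
proof (induction n)
  case 0
  have "1 \<le> 2 / \<rho>"
    using assms by (simp add: field_simps)
  then show ?case
    using assms(1) by simp
next
  case (Suc n)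
  have "v (Suc n) \<le> r * v n + 2 * q ^ n"
    using Suc by (intro assms) simp
  also have "\<dots> \<le> \<rho> * v n + 2 * \<rho> ^ n"
    using assms by (intro add_mono mult_right_mono mult_left_mono power_mono) auto
  also have "\<dots> \<le> \<rho> * (2 / \<rho> * (real (Suc n) * \<rho> ^ n)) + 2 * \<rho> ^ n"
    using Suc assms by (intro add_mono mult_left_mono) auto
  also have "\<dots> = 2 / \<rho> * (real (Suc (Suc n)) * \<rho> ^ Suc n)"
    using assms by (simp add: field_simps)
  finally show ?case .
qed

section \<open>Contraction factor of a single cut\<close>

locale atomless_unit_distribution = D: prob_space D for D :: "real measure" +
  assumes sets_D [measurable_cong]: "sets D = sets borel"
    and AE_unit: "AE x in D. 0 < x \<and> x < 1"
    and atomless: "{x} \<in> null_sets D"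
begin

definition split_mean :: "int \<Rightarrow> complex" where
  "split_mean l = D.expectation (split_char l)"

text \<open>On the positive reals a level set of the character lies in a geometric progression of
  ratio 10^(1/l). It is therefore countable, and null in the absence of atoms.\<close>

lemma AE_circle_char_neq:
  assumes "l \<noteq> 0"
  shows "AE x in D. circle_char l (log 10 x) \<noteq> w"
proof -
  define A where "A = {x. 0 < x \<and> circle_char l (log 10 x) = w}"
  have "countable A"
  proof (cases "A = {}")
    case False
    then obtain y where y: "0 < y" "circle_char l (log 10 y) = w"
      by (auto simp: A_def)
    have "A \<subseteq> (\<lambda>k. y * 10 powr (k / of_int l)) ` \<int>"
    proof
      fix x assume "x \<in> A"
      then have x: "0 < x" "circle_char l (log 10 x) = circle_char l (log 10 y)"
        using y by (auto simp: A_def)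
      then have "of_int l * log 10 x - of_int l * log 10 y \<in> \<int>"
        unfolding circle_char_eq[of l] circle_char_1_eq_iff by simp
      moreover have "x = y * 10 powr ((of_int l * log 10 x - of_int l * log 10 y) / of_int l)"
        using x y assms by (simp add: diff_divide_distrib powr_diff)
      ultimately show "x \<in> (\<lambda>k. y * 10 powr (k / of_int l)) ` \<int>"
        by (rule rev_image_eqI)
    qed
    then show ?thesis
      by (rule countable_subset) (intro countable_image countable_int)
  qed simp
  then have "(\<Union>x\<in>A. {x}) \<in> null_sets D"
    by (intro null_sets_UN' atomless)
  then have "AE x in D. x \<notin> A"
    by (intro AE_not_in) simp
  with AE_unit show ?thesis
    by eventually_elim (simp add: A_def)
qed

text \<open>Strictness for the left child is enough: the right child contributes at most 1 to the
  sum, so the mean of the two stays below 1.\<close>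

lemma norm_split_mean_less_1:
  assumes "l \<noteq> 0"
  shows "norm (split_mean l) < 1"
proof -
  define Z where "Z x = circle_char l (log 10 x)" for x
  define Z' where "Z' x = circle_char l (log 10 (1 - x))" for x
  have [measurable]: "Z \<in> borel_measurable D" "Z' \<in> borel_measurable D"
    unfolding Z_def Z'_def by measurable
  have int: "integrable D Z" "integrable D Z'"
    by (rule D.integrable_const_bound[of _ 1]; simp add: Z_def Z'_def)+
  have "norm (D.expectation Z) < 1"
    using AE_circle_char_neq[OF assms]
    by (intro D.norm_expectation_less_1) (auto simp: Z_def)
  moreover have "norm (D.expectation Z') \<le> 1"
    using integral_norm_bound[of D Z'] by (simp add: Z'_def D.prob_space)
  moreover
  have "split_mean l = (D.expectation Z + D.expectation Z') / 2"
  proof -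
    have "split_char l = (\<lambda>x. (Z x + Z' x) / 2)"
      by (simp add: fun_eq_iff split_char_def Z_def Z'_def)
    then show ?thesis
      using int by (simp add: split_mean_def)
  qed
  then have "norm (split_mean l) = norm (D.expectation Z + D.expectation Z') / 2"
    by (simp only: norm_divide norm_numeral)
  ultimately show ?thesis
    using norm_triangle_ineq[of "D.expectation Z" "D.expectation Z'"] by linarith
qed

text \<open>The larger of the contraction factor and the noise rate 1 / sqrt 2, the latter being
  positive even when the contraction factor vanishes.\<close>

definition decay_rate :: "int \<Rightarrow> real" where
  "decay_rate l = max (norm (split_mean l)) (1 / sqrt 2)"

text \<open>The bound of \<open>linear_recurrence_bound\<close> at this rate. It does not mention
  the probability space, so it can be compared across different \<open>N\<close>.\<close>

definition decay_bound :: "int \<Rightarrow> nat \<Rightarrow> real" where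
  "decay_bound l n = 2 / decay_rate l * (real (Suc n) * decay_rate l ^ n)"

lemma decay_rate: "l \<noteq> 0 \<Longrightarrow> 0 < decay_rate l \<and> decay_rate l < 1"
  using norm_split_mean_less_1[of l] by (auto simp: decay_rate_def less_max_iff_disj)

lemma decay_bound_tendsto:
  assumes "l \<noteq> 0"
  shows "decay_bound l \<longlonglongrightarrow> 0"
proof -
  have "(\<lambda>n. 2 / decay_rate l * (real n * decay_rate l ^ n + decay_rate l ^ n)) \<longlonglongrightarrow>
      2 / decay_rate l * (0 + 0)"
    using decay_rate[OF assms]
    by (intro tendsto_intros powser_times_n_limit_0 LIMSEQ_power_zero) auto
  then show ?thesis
    by (simp add: decay_bound_def[abs_def] algebra_simps)
qed

end

section \<open>The levels up to N on one fixed probability space\<close>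

locale stick_breaking = atomless_unit_distribution D + prob_space M
  for D :: "real measure" and M :: "'a measure" +
  fixes X :: "nat \<Rightarrow> 'a \<Rightarrow> real" and N :: nat and L :: real
  assumes indep: "indep_vars (\<lambda>_. borel) X {1..2 ^ N - 1}"
    and distr: "k \<in> {1..2 ^ N - 1} \<Longrightarrow> distr M borel (X k) = D"
    and L_pos: "L > 0"
begin

abbreviation stick :: "nat \<Rightarrow> 'a \<Rightarrow> real" where
  "stick k \<omega> \<equiv> stick_length L (\<lambda>j. X j \<omega>) k"

lemma measurable_X [measurable (raw)]: "k \<in> {1..2 ^ N - 1} \<Longrightarrow> X k \<in> borel_measurable M"
  using indep unfolding indep_vars_def by auto

lemma less_power_imp_mem:
  fixes k :: nat
  assumes "n < N" "1 \<le> k" "k < 2 ^ Suc n"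
  shows "k \<in> {1..2 ^ N - 1}"
proof -
  have "k < 2 ^ N"
    using assms by (intro less_le_trans[OF assms(3) power_increasing]) auto
  then show ?thesis
    using assms by auto
qed

lemma level_imp_less:
  fixes k :: nat
  assumes "n \<le> N" "k \<in> {2 ^ n..<2 ^ Suc n}"
  shows "k < 2 ^ Suc N"
  by (rule less_le_trans[OF _ power_increasing[of "Suc n"]]) (use assms in auto)

lemma AE_X: "AE \<omega> in M. \<forall>k\<in>{1..2 ^ N - 1}. 0 < X k \<omega> \<and> X k \<omega> < 1"
proof (rule AE_ball_countable[THEN iffD2], simp, intro ballI)
  fix k :: nat assume k: "k \<in> {1..2 ^ N - 1}"
  have "AE x in distr M borel (X k). 0 < x \<and> x < 1"
    using AE_unit unfolding distr[OF k] .
  then show "AE \<omega> in M. 0 < X k \<omega> \<and> X k \<omega> < 1"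
    using k by (subst (asm) AE_distr_iff) auto
qed

lemma measurable_stick:
  assumes "k < 2 ^ Suc N"
  shows "stick k \<in> borel_measurable M"
proof -
  define I where "I = {1..2 ^ N - 1 :: nat}"
  have sub: "{1..k div 2} \<subseteq> I"
    using assms by (auto simp: I_def)
  have "(\<lambda>\<omega>. restrict (\<lambda>i. X i \<omega>) I) \<in> measurable M (PiM I (\<lambda>_. borel))"
    by (intro measurable_restrict) (auto simp: I_def)
  from measurable_compose[OF this measurable_stick_length[OF sub]]
  have "(\<lambda>\<omega>. stick_length L (restrict (\<lambda>i. X i \<omega>) I) k) \<in> borel_measurable M" .
  also have "(\<lambda>\<omega>. stick_length L (restrict (\<lambda>i. X i \<omega>) I) k) = stick k"
    using sub by (intro ext stick_length_cong) auto
  finally show ?thesis .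
qed

lemma measurable_level_avg:
  fixes h :: "real \<Rightarrow> 'b::{banach, second_countable_topology}"
  assumes [measurable]: "h \<in> borel_measurable borel" and "n \<le> N"
  shows "(\<lambda>\<omega>. level_avg L (\<lambda>k. X k \<omega>) n h) \<in> borel_measurable M"
proof -
  have [measurable]: "stick k \<in> borel_measurable M" if "k \<in> {2 ^ n..<2 ^ Suc n}" for k
    using level_imp_less[OF assms(2) that] by (rule measurable_stick)
  show ?thesis
    unfolding level_avg_def by measurable
qed

lemma integrable_level_avg:
  fixes h :: "real \<Rightarrow> 'b::{banach, second_countable_topology}"
  assumes "h \<in> borel_measurable borel" "n \<le> N" "\<And>t. norm (h t) \<le> B"
  shows "integrable M (\<lambda>\<omega>. level_avg L (\<lambda>k. X k \<omega>) n h)"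
  using assms by (intro integrable_const_bound[of _ B] measurable_level_avg AE_I2 norm_level_avg_le) auto

lemma expectation_X:
  assumes "k \<in> {1..2 ^ N - 1}" and [measurable]: "h \<in> borel_measurable borel"
  shows "expectation (\<lambda>\<omega>. h (X k \<omega>)) = D.expectation (h :: real \<Rightarrow> complex)"
  using assms(1) by (subst distr[OF assms(1), symmetric]) (auto simp: integral_distr)

text \<open>The parent's character times the centred factor of its own cut; these are the terms
  whose sum measures how far one level is from exact multiplication by
  \<open>split_mean l\<close>.\<close>

definition increment :: "int \<Rightarrow> nat \<Rightarrow> 'a \<Rightarrow> complex" where
  "increment l k \<omega> = circle_char l (log 10 (stick k \<omega>)) * (split_char l (X k \<omega>) - split_mean l)"

lemma norm_split_mean_le: "norm (split_mean l) \<le> 1"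
proof -
  have "norm (split_mean l) \<le> D.expectation (\<lambda>x. norm (split_char l x))"
    unfolding split_mean_def by simp
  also have "\<dots> \<le> D.expectation (\<lambda>_. 1)"
    by (intro integral_mono D.integrable_const_bound[of _ 1]) (auto simp: norm_split_char_le)
  finally show ?thesis
    by (simp add: D.prob_space)
qed

lemma norm_split_char_diff_le: "norm (split_char l x - split_mean l) \<le> 2"
  using norm_triangle_ineq4[of "split_char l x" "split_mean l"] norm_split_char_le[of l x]
    norm_split_mean_le[of l] by linarith

lemma norm_increment_le: "norm (increment l k \<omega>) \<le> 2"
  using norm_split_char_diff_le by (simp add: increment_def norm_mult)

lemma measurable_increment:
  assumes "n < N" "k \<in> {2 ^ n..<2 ^ Suc n}"
  shows "increment l k \<in> borel_measurable M"
proof -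
  have "(1::nat) \<le> 2 ^ n"
    by simp
  then have "1 \<le> k" "k < 2 ^ Suc N"
    using assms level_imp_less[OF less_imp_le[OF assms(1)] assms(2)] by auto
  then have [measurable]: "stick k \<in> borel_measurable M" "X k \<in> borel_measurable M"
    using assms less_power_imp_mem[of n k] by (auto intro: measurable_stick)
  show ?thesis
    unfolding increment_def[abs_def] by measurable
qed

text \<open>
  The cut at \<open>j\<close> influences neither the stick at \<open>j\<close> nor anything at another node of the
  same level, so the centred factor at \<open>j\<close> splits off.
\<close>

lemma increments_orthogonal:
  assumes "n < N" and j: "j \<in> {2 ^ n..<2 ^ Suc n}" and k: "k \<in> {2 ^ n..<2 ^ Suc n}" and "j \<noteq> k"
  shows "expectation (\<lambda>\<omega>. increment l j \<omega> * cnj (increment l k \<omega>)) = 0"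
proof -
  define I where "I = {1..2 ^ N - 1} - {j}"
  have jk: "1 \<le> j" "1 \<le> k"
    using j k order_trans[OF one_le_power[of "2::nat" n]] by auto
  then have mem: "j \<in> {1..2 ^ N - 1}" "k \<in> I"
    using assms less_power_imp_mem[of n] by (auto simp: I_def)
  have sub: "{1..i div 2} \<subseteq> I" if "i \<in> {2 ^ n..<2 ^ Suc n}" for i
  proof
    fix m assume m: "m \<in> {1..i div 2}"
    then have "m < 2 ^ n"
      using that by auto
    then show "m \<in> I"
      using m j less_power_imp_mem[of n m] assms(1) by (auto simp: I_def)
  qed
  \<comment> \<open>The product of the increments is split into \<open>F\<close>, which never reads
    coordinate \<open>j\<close>, and \<open>G\<close>, which reads nothing else. Both are functions
    of coordinate tuples, so independence of the restricted families carries over to them.\<close>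
  define F where "F q = circle_char l (log 10 (stick_length L q j)) *
    cnj (circle_char l (log 10 (stick_length L q k)) * (split_char l (q k) - split_mean l))" for q
  define G where "G q = split_char l (q j) - split_mean l" for q
  have [measurable]: "F \<in> borel_measurable (PiM I (\<lambda>_. borel))"
    "G \<in> borel_measurable (PiM {j} (\<lambda>_. borel))"
  proof -
    have [measurable]: "(\<lambda>q. stick_length L q j) \<in> borel_measurable (PiM I (\<lambda>_. borel))"
      "(\<lambda>q. stick_length L q k) \<in> borel_measurable (PiM I (\<lambda>_. borel))"
      "(\<lambda>q. q k) \<in> borel_measurable (PiM I (\<lambda>_. borel :: real measure))"
      "(\<lambda>q. q j) \<in> borel_measurable (PiM {j} (\<lambda>_. borel :: real measure))"
      by (intro measurable_stick_length sub j k measurable_component_singleton mem singletonI)+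
    show "F \<in> borel_measurable (PiM I (\<lambda>_. borel))" "G \<in> borel_measurable (PiM {j} (\<lambda>_. borel))"
      unfolding F_def[abs_def] G_def[abs_def] by measurable
  qed
  define R where "R J \<omega> = restrict (\<lambda>i. X i \<omega>) J" for J \<omega>
  have "indep_var (PiM I (\<lambda>_. borel)) (R I) (PiM {j} (\<lambda>_. borel)) (R {j})"
    unfolding R_def using mem by (intro indep_var_restrict[OF indep]) (auto simp: I_def)
  then have ind: "indep_var borel (F \<circ> R I) borel (G \<circ> R {j})"
    by (rule indep_var_compose) measurable
  have F: "F (R I \<omega>) = circle_char l (log 10 (stick j \<omega>)) * cnj (increment l k \<omega>)" for \<omega>
  proof -
    have "stick_length L (R I \<omega>) i = stick i \<omega>" if "i \<in> {j, k}" for i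
    proof (rule stick_length_cong)
      fix m assume "m \<in> {1..i div 2}"
      then have "m \<in> I"
        using sub[of i] that j k by blast
      then show "R I \<omega> m = X m \<omega>"
        by (simp add: R_def)
    qed
    then show ?thesis
      using mem by (simp add: F_def increment_def R_def)
  qed
  have G: "G (R {j} \<omega>) = split_char l (X j \<omega>) - split_mean l" for \<omega>
    by (simp add: G_def R_def)
  have G_int: "integrable M (G \<circ> R {j})"
    using ind by (intro integrable_const_bound[of _ 2])
      (auto simp: G norm_split_char_diff_le dest: indep_var_rv2)
  have F_int: "integrable M (F \<circ> R I)"
    using ind by (intro integrable_const_bound[of _ 2])
      (auto simp: F norm_mult norm_increment_le dest: indep_var_rv1)
  have "expectation (G \<circ> R {j}) = expectation (\<lambda>\<omega>. split_char l (X j \<omega>)) - split_mean l"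
  proof -
    have "integrable M (\<lambda>\<omega>. split_char l (X j \<omega>))"
      using mem(1) by (intro integrable_const_bound[of _ 1]) (auto simp: norm_split_char_le)
    then show ?thesis
      by (simp add: comp_def G prob_space)
  qed
  also have "\<dots> = 0"
    using mem(1) by (simp add: expectation_X split_mean_def)
  finally have "expectation (\<lambda>\<omega>. (F \<circ> R I) \<omega> * (G \<circ> R {j}) \<omega>) = 0"
    using indep_var_lebesgue_integral[OF ind F_int G_int] by (simp add: comp_def)
  then show ?thesis
    by (simp add: F G increment_def mult.assoc mult.left_commute mult.commute)
qed

text \<open>The sum \<open>U\<close> of the increments is controlled in L^2 by orthogonality and
  then in L^1 by Jensen's inequality, giving E|U| <= 2 * sqrt 2 ^ n.\<close>

lemma expectation_norm_level_avg_Suc: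
  assumes "n < N"
  shows "expectation (\<lambda>\<omega>. norm (level_avg L (\<lambda>k. X k \<omega>) (Suc n) (circle_char l))) \<le>
    norm (split_mean l) * expectation (\<lambda>\<omega>. norm (level_avg L (\<lambda>k. X k \<omega>) n (circle_char l)))
      + 2 * (1 / sqrt 2) ^ n"
proof -
  define W where "W m \<omega> = level_avg L (\<lambda>k. X k \<omega>) m (circle_char l)" for m \<omega>
  define U where "U \<omega> = (\<Sum>k\<in>{2 ^ n..<2 ^ Suc n :: nat}. increment l k \<omega>)" for \<omega>
  have W_int: "integrable M (W m)" if "m \<le> N" for m
    unfolding W_def using that by (intro integrable_level_avg[of _ _ 1]) auto
  have [measurable]: "U \<in> borel_measurable M"
    unfolding U_def using assms by (intro borel_measurable_sum measurable_increment[of n]) auto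
  have "norm (U \<omega>) \<le> (\<Sum>k\<in>{2 ^ n..<2 ^ Suc n :: nat}. 2)" for \<omega>
    unfolding U_def by (intro sum_norm_le norm_increment_le)
  then have U_bound: "norm (U \<omega>) \<le> 2 * 2 ^ n" for \<omega>
    by (simp add: mult.commute)
  have U_int: "integrable M (\<lambda>\<omega>. norm (U \<omega>))" "integrable M (\<lambda>\<omega>. (norm (U \<omega>))\<^sup>2)"
    by (rule integrable_const_bound[of _ "2 * 2 ^ n"] integrable_const_bound[of _ "(2 * 2 ^ n)\<^sup>2"];
        use U_bound power_mono[OF U_bound norm_ge_zero, where n = 2] in simp)+
  have "(expectation (\<lambda>\<omega>. norm (U \<omega>)))\<^sup>2 \<le> expectation (\<lambda>\<omega>. (norm (U \<omega>))\<^sup>2)"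
    by (intro square_expectation_le U_int)
  also have "\<dots> \<le> real (card {2 ^ n..<2 ^ Suc n :: nat}) * 2\<^sup>2"
    unfolding U_def using assms
    by (intro expectation_norm_sum_orthogonal norm_increment_le measurable_increment[of n]
        increments_orthogonal[of n]) auto
  also have "\<dots> = (2 * sqrt 2 ^ n)\<^sup>2"
  proof -
    have "(sqrt 2 ^ n)\<^sup>2 = 2 ^ n"
      by (simp add: power2_eq_square flip: power_mult_distrib)
    then show ?thesis
      by (simp only: power_mult_distrib) simp
  qed
  finally have U: "expectation (\<lambda>\<omega>. norm (U \<omega>)) \<le> 2 * sqrt 2 ^ n"
    by (rule power2_le_imp_le) simp
  \<comment> \<open>Only almost everywhere, since the recursion for \<open>W\<close> requires all
    cuts of the levels up to n to lie strictly between 0 and 1.\<close>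
  have "AE \<omega> in M. norm (W (Suc n) \<omega>) \<le> norm (split_mean l) * norm (W n \<omega>) + norm (U \<omega>) / 2 ^ n"
    using AE_X
  proof eventually_elim
    case (elim \<omega>)
    have "W (Suc n) \<omega> = split_mean l * W n \<omega> + (1 / 2 ^ n) *\<^sub>R U \<omega>"
    proof -
      have "W (Suc n) \<omega> = (1 / 2 ^ n) *\<^sub>R
          (\<Sum>k\<in>{2 ^ n..<2 ^ Suc n}. circle_char l (log 10 (stick k \<omega>)) * split_char l (X k \<omega>))"
        unfolding W_def using elim L_pos less_power_imp_mem[OF assms]
        by (intro level_avg_Suc) auto
      also have "(\<Sum>k\<in>{2 ^ n..<2 ^ Suc n}. circle_char l (log 10 (stick k \<omega>)) * split_char l (X k \<omega>)) =
          split_mean l * (\<Sum>k\<in>{2 ^ n..<2 ^ Suc n}. circle_char l (log 10 (stick k \<omega>))) + U \<omega>"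
        unfolding U_def sum_distrib_left sum.distrib[symmetric]
        by (intro sum.cong refl) (simp add: increment_def algebra_simps)
      finally show ?thesis
        by (simp add: W_def level_avg_def scaleR_right_distrib)
    qed
    then show ?case
      using norm_triangle_ineq[of "split_mean l * W n \<omega>" "(1 / 2 ^ n) *\<^sub>R U \<omega>"]
      by (simp add: norm_mult)
  qed
  then have "expectation (\<lambda>\<omega>. norm (W (Suc n) \<omega>)) \<le>
      expectation (\<lambda>\<omega>. norm (split_mean l) * norm (W n \<omega>) + norm (U \<omega>) / 2 ^ n)"
    using assms U_int(1) W_int[of n] W_int[of "Suc n"] by (intro integral_mono_AE) auto
  also have "\<dots> = norm (split_mean l) * expectation (\<lambda>\<omega>. norm (W n \<omega>)) + expectation (\<lambda>\<omega>. norm (U \<omega>)) / 2 ^ n"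
    using assms U_int(1) W_int[of n] by simp
  also have "expectation (\<lambda>\<omega>. norm (U \<omega>)) / 2 ^ n \<le> 2 * sqrt 2 ^ n / 2 ^ n"
    by (intro divide_right_mono U) simp
  also have "\<dots> = 2 * (sqrt 2 / 2) ^ n"
    by (simp add: power_divide)
  also have "sqrt 2 / 2 = 1 / sqrt 2"
    by (simp add: field_simps)
  finally show ?thesis
    by (simp add: W_def)
qed

lemma expectation_norm_level_avg_char:
  assumes "l \<noteq> 0"
  shows "expectation (\<lambda>\<omega>. norm (level_avg L (\<lambda>k. X k \<omega>) N (circle_char l))) \<le> decay_bound l N"
  unfolding decay_bound_def
proof (rule linear_recurrence_bound[OF _ expectation_norm_level_avg_Suc])
  show "expectation (\<lambda>\<omega>. norm (level_avg L (\<lambda>k. X k \<omega>) 0 (circle_char l))) \<le> 1"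
    by (simp add: level_avg_def prob_space numeral_2_eq_2)
qed (use decay_rate[OF assms] in \<open>auto simp: decay_rate_def\<close>)

end

section \<open>Equidistribution of the significands\<close>

text \<open>All data are explicit parameters, outside any locale, so that limits in \<open>N\<close>
  along changing probability spaces can be stated.\<close>

definition deviation :: "'a measure \<Rightarrow> (nat \<Rightarrow> 'a \<Rightarrow> real) \<Rightarrow> nat \<Rightarrow> real \<Rightarrow> (real \<Rightarrow> complex) \<Rightarrow> real" where
  "deviation M X N L h = (\<integral>\<omega>. norm (level_avg L (\<lambda>k. X k \<omega>) N h - integral {0..1} h) \<partial>M)"

lemma deviation_nonneg: "0 \<le> deviation M X N L h"
  by (simp add: deviation_def)

context stick_breaking
begin

lemma integrable_deviation:
  assumes "continuous_on UNIV h" "\<And>t. norm (h t) \<le> B"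
  shows "integrable M (\<lambda>\<omega>. norm (level_avg L (\<lambda>k. X k \<omega>) N h - integral {0..1} h :: complex))"
  using assms
  by (intro integrable_norm Bochner_Integration.integrable_diff integrable_level_avg[of _ _ B])
    (auto intro: borel_measurable_continuous_onI)

lemma deviation_char:
  "deviation M X N L (circle_char l) \<le> (if l = 0 then 0 else decay_bound l N)"
proof (cases "l = 0")
  case True
  have "circle_char 0 = (\<lambda>_. 1)"
    by auto
  then show ?thesis
    using True integral_circle_char[of 0] by (simp add: deviation_def level_avg_const)
next
  case False
  then show ?thesis
    using expectation_norm_level_avg_char[of l] integral_circle_char[of l] by (simp add: deviation_def)
qed

lemma deviation_add:
  assumes "trig_poly g" "trig_poly h"
  shows "deviation M X N L (\<lambda>t. g t + h t) \<le> deviation M X N L g + deviation M X N L h"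
proof -
  obtain B C where B: "\<And>t. norm (g t) \<le> B" and C: "\<And>t. norm (h t) \<le> C"
    using assms trig_poly_bounded by meson
  note int = integrable_deviation[OF trig_poly_continuous[OF assms(1)] B]
    integrable_deviation[OF trig_poly_continuous[OF assms(2)] C]
  have "integral {0..1} (\<lambda>t. g t + h t) = integral {0..1} g + integral {0..1} h"
    by (intro Henstock_Kurzweil_Integration.integral_add integrable_continuous_real trig_poly_continuous assms)
  then have le: "norm (level_avg L p N (\<lambda>t. g t + h t) - integral {0..1} (\<lambda>t. g t + h t)) \<le>
      norm (level_avg L p N g - integral {0..1} g) + norm (level_avg L p N h - integral {0..1} h)" for p
    by (simp only: level_avg_add add_diff_add norm_triangle_ineq)
  have "deviation M X N L (\<lambda>t. g t + h t) \<le>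
      expectation (\<lambda>\<omega>. norm (level_avg L (\<lambda>k. X k \<omega>) N g - integral {0..1} g) +
        norm (level_avg L (\<lambda>k. X k \<omega>) N h - integral {0..1} h))"
    unfolding deviation_def
  proof (rule integral_mono[OF _ _ le])
    show "integrable M (\<lambda>\<omega>. norm (level_avg L (\<lambda>k. X k \<omega>) N (\<lambda>t. g t + h t) - integral {0..1} (\<lambda>t. g t + h t)))"
      by (intro integrable_deviation[where B = "B + C"] trig_poly_continuous trig_poly.add assms norm_triangle_mono B C)
  qed (intro Bochner_Integration.integrable_add int)
  also have "\<dots> = deviation M X N L g + deviation M X N L h"
    unfolding deviation_def by (intro Bochner_Integration.integral_add int)
  finally show ?thesis .
qed

lemma deviation_scale:
  "deviation M X N L (\<lambda>t. c * h t) = norm c * deviation M X N L h"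
  by (simp add: deviation_def level_avg_mult norm_mult flip: right_diff_distrib)

text \<open>The error \<open>e\<close> is paid twice, once in the level average and once in the
  integral.\<close>

lemma deviation_uniform_approx:
  assumes g: "continuous_on UNIV g" and h: "trig_poly h"
    and le: "\<And>t. norm (g t - h t) \<le> e"
  shows "deviation M X N L g \<le> deviation M X N L h + 2 * e"
proof -
  obtain B where B: "\<And>t. norm (h t) \<le> B"
    using h trig_poly_bounded by meson
  have gB: "norm (g t) \<le> e + B" for t
    using norm_triangle_mono[OF le[of t] B[of t]] by simp
  note int = integrable_deviation[OF g gB] integrable_deviation[OF trig_poly_continuous[OF h] B]
  have "integral {0..1} (\<lambda>t. g t - h t) = integral {0..1} g - integral {0..1} h"
    by (intro Henstock_Kurzweil_Integration.integral_diff integrable_continuous_real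
        trig_poly_continuous[OF h] continuous_on_subset[OF g subset_UNIV])
  moreover have "norm (integral {0..1} (\<lambda>t. g t - h t)) \<le> e * (1 - 0)"
    using continuous_on_subset[OF g subset_UNIV]
    by (intro integral_bound le continuous_on_diff trig_poly_continuous[OF h]) auto
  ultimately have i: "norm (integral {0..1} g - integral {0..1} h) \<le> e"
    by simp
  have ptw: "norm (level_avg L p N g - integral {0..1} g) \<le>
      norm (level_avg L p N h - integral {0..1} h) + 2 * e" for p
  proof -
    have a: "norm (level_avg L p N g - level_avg L p N h) \<le> e"
      using norm_level_avg_le[of "\<lambda>t. g t - h t" e, OF le] by (simp add: level_avg_diff)
    have "level_avg L p N g - integral {0..1} g = (level_avg L p N h - integral {0..1} h) +
        ((level_avg L p N g - level_avg L p N h) - (integral {0..1} g - integral {0..1} h))"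
      by simp
    also have "norm \<dots> \<le> norm (level_avg L p N h - integral {0..1} h) + (e + e)"
      by (intro norm_triangle_mono order_refl order_trans[OF norm_triangle_ineq4] add_mono a i)
    finally show ?thesis
      by simp
  qed
  have "deviation M X N L g \<le>
      expectation (\<lambda>\<omega>. norm (level_avg L (\<lambda>k. X k \<omega>) N h - integral {0..1} h) + 2 * e)"
    unfolding deviation_def using int by (intro integral_mono ptw) auto
  also have "\<dots> = deviation M X N L h + 2 * e"
    unfolding deviation_def using int by (simp add: prob_space)
  finally show ?thesis .
qed

lemma AE_stick_pos: "AE \<omega> in M. \<forall>k\<in>{2 ^ N..<2 ^ Suc N}. stick k \<omega> > 0"
  using AE_X
proof eventually_elim
  case (elim \<omega>)
  show ?case
  proof
    fix k :: nat assume "k \<in> {2 ^ N..<2 ^ Suc N}"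
    then show "stick k \<omega> > 0"
      using elim L_pos by (intro stick_length_pos) auto
  qed
qed

text \<open>Pointwise, P <= log 10 s + e + d g from the first majorant and 1 - P <= 1 - log 10 s + e
  + d h from the second. Only one of the two bounds is active at a time, so \<open>e\<close> enters
  once.\<close>

lemma expectation_sig_fraction_deviation:
  assumes s: "1 \<le> s"
    and g: "continuous_on UNIV g" "\<And>z. 0 \<le> g z"
      "\<And>t. t \<in> {0..log 10 s} \<Longrightarrow> g (circle_char 1 t) = 1"
      "integral {0..1} (\<lambda>t. g (circle_char 1 t)) \<le> log 10 s + e"
    and h: "continuous_on UNIV h" "\<And>z. 0 \<le> h z"
      "\<And>t. t \<in> {log 10 s..1} \<Longrightarrow> h (circle_char 1 t) = 1"
      "integral {0..1} (\<lambda>t. h (circle_char 1 t)) \<le> 1 - log 10 s + e"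
  shows "expectation (\<lambda>\<omega>. \<bar>sig_fraction L (\<lambda>k. X k \<omega>) N s - log 10 s\<bar>) \<le>
    deviation M X N L (\<lambda>t. g (circle_char 1 t)) + deviation M X N L (\<lambda>t. h (circle_char 1 t)) + e"
    (is "expectation ?P \<le> _")
proof -
  \<comment> \<open>\<open>deviation\<close> is defined for complex functions, whereas the
    comparison with \<open>phi\<close> is real; \<open>d_eq\<close> translates between the
    two.\<close>
  define d where "d u \<omega> = norm (level_avg L (\<lambda>k. X k \<omega>) N (\<lambda>t. complex_of_real (u (circle_char 1 t))) -
    integral {0..1} (\<lambda>t. complex_of_real (u (circle_char 1 t))))" for u \<omega>
  have d_eq: "d u \<omega> = \<bar>level_avg L (\<lambda>k. X k \<omega>) N (\<lambda>t. u (circle_char 1 t)) -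
      integral {0..1} (\<lambda>t. u (circle_char 1 t))\<bar>"
    if "continuous_on UNIV u" for u \<omega>
  proof -
    have "(\<lambda>t. u (circle_char 1 t)) integrable_on {0..1}"
      by (intro integrable_continuous_real continuous_on_compose2[OF that] continuous_intros) auto
    then have "integral {0..1} (\<lambda>t. complex_of_real (u (circle_char 1 t))) =
        of_real (integral {0..1} (\<lambda>t. u (circle_char 1 t)))"
      using integral_linear[OF _ bounded_linear_of_real] by (simp add: comp_def)
    then show ?thesis
      unfolding d_def level_avg_of_real by (simp flip: of_real_diff)
  qed
  have d_int: "integrable M (d u)" if "continuous_on UNIV u" for u
  proof -
    have cont: "continuous_on UNIV (\<lambda>t. complex_of_real (u (circle_char 1 t)))"
      by (intro continuous_intros continuous_on_compose2[OF that]) auto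
    \<comment> \<open>The function \<open>u\<close> may be unbounded on the plane, but only its
      values on the unit circle occur.\<close>
    have "compact (u ` sphere 0 1)"
      by (intro compact_continuous_image continuous_on_subset[OF that]) auto
    then obtain B where "\<And>z. z \<in> sphere 0 1 \<Longrightarrow> norm (u z) \<le> B"
      by (meson bounded_iff compact_imp_bounded imageI)
    then have "norm (complex_of_real (u (circle_char 1 t))) \<le> B" for t
      by simp
    from integrable_deviation[OF cont this] show ?thesis
      by (simp add: d_def[abs_def])
  qed
  have avg_le: "sig_fraction L (\<lambda>k. X k \<omega>) N s \<le> level_avg L (\<lambda>k. X k \<omega>) N (\<lambda>t. g (circle_char 1 t))"
    "1 - sig_fraction L (\<lambda>k. X k \<omega>) N s \<le> level_avg L (\<lambda>k. X k \<omega>) N (\<lambda>t. h (circle_char 1 t))"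
    if pos: "\<forall>k\<in>{2 ^ N..<2 ^ Suc N}. stick k \<omega> > 0" for \<omega>
  proof -
    show "sig_fraction L (\<lambda>k. X k \<omega>) N s \<le> level_avg L (\<lambda>k. X k \<omega>) N (\<lambda>t. g (circle_char 1 t))"
      unfolding sig_fraction_altdef level_avg_def real_scaleR_def using pos s
      by (intro mult_left_mono sum_mono phi_le_majorant g) auto
    have "1 - sig_fraction L (\<lambda>k. X k \<omega>) N s =
        (1 / 2 ^ N) * (\<Sum>k\<in>{2 ^ N..<2 ^ Suc N}. 1 - phi s (stick k \<omega>))"
      by (simp add: sig_fraction_altdef sum_subtractf diff_divide_distrib)
    also have "\<dots> \<le> level_avg L (\<lambda>k. X k \<omega>) N (\<lambda>t. h (circle_char 1 t))"
      unfolding level_avg_def real_scaleR_def using pos s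
      by (intro mult_left_mono sum_mono one_minus_phi_le_majorant h) auto
    finally show "1 - sig_fraction L (\<lambda>k. X k \<omega>) N s \<le> level_avg L (\<lambda>k. X k \<omega>) N (\<lambda>t. h (circle_char 1 t))" .
  qed
  have "AE \<omega> in M. ?P \<omega> \<le> d g \<omega> + d h \<omega> + e"
    using AE_stick_pos
  proof eventually_elim
    case (elim \<omega>)
    show ?case
      using avg_le[OF elim] g(4) h(4) unfolding d_eq[OF g(1)] d_eq[OF h(1)] by linarith
  qed
  then have "expectation ?P \<le> expectation (\<lambda>\<omega>. d g \<omega> + d h \<omega> + e)"
    using d_int[OF g(1)] d_int[OF h(1)] by (intro integral_mono_AE') auto
  also have "\<dots> = expectation (d g) + expectation (d h) + e"
    using d_int[OF g(1)] d_int[OF h(1)] by (simp add: prob_space)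
  finally show ?thesis
    by (simp add: d_def[abs_def] deviation_def)
qed

lemma measurable_sig_fraction: "(\<lambda>\<omega>. sig_fraction L (\<lambda>k. X k \<omega>) N s) \<in> borel_measurable M"
proof -
  have [measurable]: "stick k \<in> borel_measurable M" if "k \<in> {2 ^ N..<2 ^ Suc N}" for k
    using that by (intro measurable_stick) auto
  show ?thesis
    unfolding sig_fraction_altdef by measurable
qed

lemma sig_fraction_bounds: "0 \<le> sig_fraction L p N s" "sig_fraction L p N s \<le> 1"
proof -
  have "0 \<le> phi s x" "phi s x \<le> 1" for x
    by (auto simp: phi_def)
  then have "0 \<le> (\<Sum>k\<in>{2 ^ N..<2 ^ Suc N}. phi s (stick_length L p k))"
    "(\<Sum>k\<in>{2 ^ N..<2 ^ Suc N}. phi s (stick_length L p k)) \<le> (\<Sum>k\<in>{2 ^ N..<2 ^ Suc N :: nat}. 1)"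
    by (intro sum_nonneg sum_mono; simp)+
  then show "0 \<le> sig_fraction L p N s" "sig_fraction L p N s \<le> 1"
    by (simp_all add: sig_fraction_altdef field_simps)
qed

text \<open>The variance is the mean square deviation from c minus the squared bias, hence at most
  the former; and squaring does not increase |P - c|, which is at most 1.\<close>

lemma mean_variance_le_deviation:
  fixes s :: real
  assumes c: "0 \<le> c" "c \<le> 1"
  defines "P \<equiv> \<lambda>\<omega>. sig_fraction L (\<lambda>k. X k \<omega>) N s"
  shows "\<bar>expectation P - c\<bar> \<le> expectation (\<lambda>\<omega>. \<bar>P \<omega> - c\<bar>)"
    and "variance P \<le> expectation (\<lambda>\<omega>. \<bar>P \<omega> - c\<bar>)"
proof -
  have [measurable]: "P \<in> borel_measurable M"
    unfolding P_def by (rule measurable_sig_fraction)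
  have P: "0 \<le> P \<omega>" "P \<omega> \<le> 1" for \<omega>
    by (simp_all add: P_def sig_fraction_bounds)
  have P_c: "\<bar>P \<omega> - c\<bar> \<le> 1" for \<omega>
    using P[of \<omega>] c by linarith
  have int: "integrable M P" "integrable M (\<lambda>\<omega>. (P \<omega>)\<^sup>2)" "integrable M (\<lambda>\<omega>. \<bar>P \<omega> - c\<bar>)"
    by (rule integrable_const_bound[of _ 1]; use P P_c power_le_one[OF P, where n = 2] in simp)+
  have "expectation P - c = expectation (\<lambda>\<omega>. P \<omega> - c)"
    using int by (simp add: prob_space)
  then show "\<bar>expectation P - c\<bar> \<le> expectation (\<lambda>\<omega>. \<bar>P \<omega> - c\<bar>)"
    using integral_abs_bound[of M "\<lambda>\<omega>. P \<omega> - c"] by simp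
  have expand: "(P \<omega> - c)\<^sup>2 = (P \<omega>)\<^sup>2 - 2 * c * P \<omega> + c\<^sup>2" for \<omega>
    by (simp add: power2_eq_square algebra_simps)
  have "expectation (\<lambda>\<omega>. (P \<omega> - c)\<^sup>2) = variance P + (expectation P - c)\<^sup>2"
    unfolding expand variance_eq[OF int(1,2)] using int
    by (simp add: prob_space power2_eq_square algebra_simps)
  then have "variance P \<le> expectation (\<lambda>\<omega>. (P \<omega> - c)\<^sup>2)"
    by simp
  also have "\<dots> \<le> expectation (\<lambda>\<omega>. \<bar>P \<omega> - c\<bar>)"
  proof (rule integral_mono)
    show "integrable M (\<lambda>\<omega>. (P \<omega> - c)\<^sup>2)"
      unfolding expand using int by simp
    fix \<omega>
    have "\<bar>P \<omega> - c\<bar> * \<bar>P \<omega> - c\<bar> \<le> 1 * \<bar>P \<omega> - c\<bar>"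
      by (intro mult_right_mono P_c) auto
    then show "(P \<omega> - c)\<^sup>2 \<le> \<bar>P \<omega> - c\<bar>"
      by (simp add: power2_eq_square)
  qed (rule int)
  finally show "variance P \<le> expectation (\<lambda>\<omega>. \<bar>P \<omega> - c\<bar>)" .
qed

end

section \<open>Passage to the limit along a sequence of probability spaces\<close>

context atomless_unit_distribution
begin

context
  fixes M :: "nat \<Rightarrow> 'a measure" and X :: "nat \<Rightarrow> nat \<Rightarrow> 'a \<Rightarrow> real" and L :: real
  assumes stick_breaking: "N \<ge> 1 \<Longrightarrow> stick_breaking D (M N) (X N) N L"
begin

lemma deviation_trig_poly_tendsto:
  assumes "trig_poly h"
  shows "(\<lambda>N. deviation (M N) (X N) N L h) \<longlonglongrightarrow> 0"
  using assms
proof induction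
  case (char l)
  show ?case
  proof (rule tendsto_sandwich[OF _ _ tendsto_const])
    show "\<forall>\<^sub>F N in sequentially. deviation (M N) (X N) N L (circle_char l) \<le> (if l = 0 then 0 else decay_bound l N)"
      by (intro eventually_sequentiallyI[of 1] stick_breaking.deviation_char[OF stick_breaking])
    show "(\<lambda>N. if l = 0 then 0 else decay_bound l N) \<longlonglongrightarrow> 0"
      using decay_bound_tendsto[of l] by (cases "l = 0") simp_all
  qed (simp add: deviation_nonneg)
next
  case (add g h)
  show ?case
  proof (rule tendsto_sandwich[OF _ _ tendsto_const])
    show "\<forall>\<^sub>F N in sequentially. deviation (M N) (X N) N L (\<lambda>t. g t + h t) \<le>
        deviation (M N) (X N) N L g + deviation (M N) (X N) N L h"
      by (intro eventually_sequentiallyI[of 1] stick_breaking.deviation_add[OF stick_breaking] add)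
    show "(\<lambda>N. deviation (M N) (X N) N L g + deviation (M N) (X N) N L h) \<longlonglongrightarrow> 0"
      using tendsto_add[OF add.IH] by simp
  qed (simp add: deviation_nonneg)
next
  case (scale g c)
  have "\<forall>\<^sub>F N in sequentially. norm c * deviation (M N) (X N) N L g =
      deviation (M N) (X N) N L (\<lambda>t. c * g t)"
    by (intro eventually_sequentiallyI[of 1] stick_breaking.deviation_scale[OF stick_breaking, symmetric])
  moreover have "(\<lambda>N. norm c * deviation (M N) (X N) N L g) \<longlonglongrightarrow> 0"
    using tendsto_mult_left[OF scale.IH, of "norm c"] by simp
  ultimately show ?case
    by (rule Lim_transform_eventually[rotated])
qed

lemma deviation_continuous_tendsto:
  fixes g :: "complex \<Rightarrow> real"
  assumes g: "continuous_on UNIV g"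
  shows "(\<lambda>N. deviation (M N) (X N) N L (\<lambda>t. g (circle_char 1 t))) \<longlonglongrightarrow> 0"
proof (rule order_tendstoI)
  fix a :: real assume "a < 0"
  then show "\<forall>\<^sub>F N in sequentially. a < deviation (M N) (X N) N L (\<lambda>t. g (circle_char 1 t))"
    by (intro always_eventually allI less_le_trans[OF _ deviation_nonneg])
next
  fix a :: real assume a: "0 < a"
  \<comment> \<open>Of the three shares of \<open>a\<close>, two cover the approximation error in
    average and integral; the third is left for the deviation of \<open>h\<close>.\<close>
  obtain h where h: "trig_poly h" "\<And>t. norm (of_real (g (circle_char 1 t)) - h t) < a / 3"
    using trig_poly_dense[OF continuous_on_subset[OF g subset_UNIV], of "a / 3"] a by auto
  have cont: "continuous_on UNIV (\<lambda>t. complex_of_real (g (circle_char 1 t)))"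
    by (intro continuous_intros continuous_on_compose2[OF g]) auto
  have "\<forall>\<^sub>F N in sequentially. deviation (M N) (X N) N L h < a / 3"
    using deviation_trig_poly_tendsto[OF h(1)] a by (intro order_tendstoD) auto
  then show "\<forall>\<^sub>F N in sequentially. deviation (M N) (X N) N L (\<lambda>t. g (circle_char 1 t)) < a"
    using eventually_ge_at_top[of 1]
  proof eventually_elim
    case (elim N)
    have "deviation (M N) (X N) N L (\<lambda>t. g (circle_char 1 t)) \<le> deviation (M N) (X N) N L h + 2 * (a / 3)"
      using h by (intro stick_breaking.deviation_uniform_approx[OF stick_breaking[OF elim(2)]] cont)
        (auto intro: less_imp_le)
    then show ?case
      using elim by simp
  qed
qed

lemma sig_fraction_L1_tendsto:
  assumes s: "s \<in> {1..<10}"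
  shows "(\<lambda>N. \<integral>\<omega>. \<bar>sig_fraction L (\<lambda>k. X N k \<omega>) N s - log 10 s\<bar> \<partial>M N) \<longlonglongrightarrow> 0"
proof (rule order_tendstoI)
  fix a :: real assume "a < 0"
  then show "\<forall>\<^sub>F N in sequentially. a < (\<integral>\<omega>. \<bar>sig_fraction L (\<lambda>k. X N k \<omega>) N s - log 10 s\<bar> \<partial>M N)"
    by (intro always_eventually allI less_le_trans[OF _ Bochner_Integration.integral_nonneg]) auto
next
  fix a :: real assume a: "0 < a"
  have "0 \<le> log 10 s" "log 10 s \<le> 1"
    using s by auto
  note \<sigma> = this
  \<comment> \<open>One third of \<open>a\<close> is the slack in the majorant integrals; the other
    two absorb the deviations of \<open>g\<close> and \<open>h\<close>.\<close>
  obtain g where g: "continuous_on UNIV g" "\<And>z. 0 \<le> g z"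
      "\<And>t. t \<in> {0..log 10 s} \<Longrightarrow> g (circle_char 1 t) = 1"
      "integral {0..1} (\<lambda>t. g (circle_char 1 t)) \<le> log 10 s - 0 + a / 3"
    using arc_majorant[of 0 "log 10 s" "a / 3"] \<sigma> a by auto
  obtain h where h: "continuous_on UNIV h" "\<And>z. 0 \<le> h z"
      "\<And>t. t \<in> {log 10 s..1} \<Longrightarrow> h (circle_char 1 t) = 1"
      "integral {0..1} (\<lambda>t. h (circle_char 1 t)) \<le> 1 - log 10 s + a / 3"
    using arc_majorant[of "log 10 s" 1 "a / 3"] \<sigma> a by auto
  have "\<forall>\<^sub>F N in sequentially. deviation (M N) (X N) N L (\<lambda>t. g (circle_char 1 t)) < a / 3"
    "\<forall>\<^sub>F N in sequentially. deviation (M N) (X N) N L (\<lambda>t. h (circle_char 1 t)) < a / 3"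
    using a by (intro order_tendstoD(2)[OF deviation_continuous_tendsto] g h; simp)+
  then show "\<forall>\<^sub>F N in sequentially. (\<integral>\<omega>. \<bar>sig_fraction L (\<lambda>k. X N k \<omega>) N s - log 10 s\<bar> \<partial>M N) < a"
    using eventually_ge_at_top[of 1]
  proof eventually_elim
    case (elim N)
    have "(\<integral>\<omega>. \<bar>sig_fraction L (\<lambda>k. X N k \<omega>) N s - log 10 s\<bar> \<partial>M N) \<le>
        deviation (M N) (X N) N L (\<lambda>t. g (circle_char 1 t)) +
        deviation (M N) (X N) N L (\<lambda>t. h (circle_char 1 t)) + a / 3"
      using s g h by (intro stick_breaking.expectation_sig_fraction_deviation[OF stick_breaking[OF elim(3)]]) auto
    then show ?case
      using elim by simp
  qed
qed

end

end

section \<open>From a density to the abstract setting, and conclusion\<close>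

lemma atomless_unit_distribution_density:
  assumes [measurable]: "(\<lambda>x. ennreal (f x)) \<in> borel_measurable borel"
    and supp: "\<And>x. x \<notin> {0<..<1} \<Longrightarrow> f x = 0"
    and total: "(\<integral>\<^sup>+x. ennreal (f x) \<partial>lborel) = 1"
  shows "atomless_unit_distribution (density lborel (\<lambda>x. ennreal (f x)))"
proof -
  have "prob_space (density lborel (\<lambda>x. ennreal (f x)))"
    by (rule prob_spaceI) (simp add: emeasure_density total)
  moreover
  have "AE x in density lborel (\<lambda>x. ennreal (f x)). 0 < x \<and> x < 1"
  proof (subst AE_density)
    have "0 < x \<and> x < 1" if "0 < ennreal (f x)" for x
      using supp[of x] that by force
    then show "AE x in lborel. 0 < ennreal (f x) \<longrightarrow> 0 < x \<and> x < 1"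
      by simp
  qed simp
  moreover have "{x} \<in> null_sets (density lborel (\<lambda>x. ennreal (f x)))" for x
    by (intro null_setsI) (simp_all add: emeasure_density nn_integral_indicator_singleton)
  ultimately show ?thesis
    by (simp add: atomless_unit_distribution_def atomless_unit_distribution_axioms_def)
qed

theorem theorem1p5:
  fixes f :: "real \<Rightarrow> real" and L :: real
    and M :: "nat \<Rightarrow> 'a measure" and p :: "nat \<Rightarrow> nat \<Rightarrow> 'a \<Rightarrow> real"
  assumes "continuous_on {0<..<1} f"
    and "\<And>x. f x \<ge> 0"
    and "\<And>x. x \<notin> {0<..<1} \<Longrightarrow> f x = 0"
    and "(\<integral>\<^sup>+x. ennreal (f x) \<partial>lborel) = 1"
    and "mellin_condition f"
    and "mellin_condition (\<lambda>x. f (1 - x))"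
    and "L > 0"
    and "\<And>N. N \<ge> 1 \<Longrightarrow> prob_space (M N)"
    and "\<And>N. N \<ge> 1 \<Longrightarrow> prob_space.indep_vars (M N) (\<lambda>_. borel) (p N) {1..2 ^ N - 1}"
    and "\<And>N k. N \<ge> 1 \<Longrightarrow> k \<in> {1..2 ^ N - 1} \<Longrightarrow>
           distributed (M N) lborel (p N k) (\<lambda>x. ennreal (f x))"
  shows "\<forall>s\<in>{1..<10}.
      (\<lambda>N. prob_space.expectation (M N) (\<lambda>\<omega>. sig_fraction L (\<lambda>k. p N k \<omega>) N s)) \<longlonglongrightarrow> log 10 s \<and>
      (\<lambda>N. prob_space.variance (M N) (\<lambda>\<omega>. sig_fraction L (\<lambda>k. p N k \<omega>) N s)) \<longlonglongrightarrow> 0"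
proof
  fix s :: real assume s: "s \<in> {1..<10}"
  define D where "D = density lborel (\<lambda>x. ennreal (f x))"
  \<comment> \<open>Measurability of the density is part of \<open>distributed\<close>; it is read
    off from the only cut of the case N = 1.\<close>
  have "(\<lambda>x. ennreal (f x)) \<in> borel_measurable borel"
    using assms(10)[of 1 1] by (simp add: distributed_def)
  then interpret atomless_unit_distribution D
    unfolding D_def using assms(3,4) by (rule atomless_unit_distribution_density)
  have sb: "stick_breaking D (M N) (p N) N L" if N: "N \<ge> 1" for N
  proof -
    interpret prob_space "M N"
      by (rule assms(8)[OF N])
    show ?thesis
    proof unfold_locales
      show "distr (M N) borel (p N k) = D" if k: "k \<in> {1..2 ^ N - 1}" for k
      proof -
        \<comment> \<open>The image measure depends on the target only through its sets, which
          \<open>borel\<close> and \<open>lborel\<close> share.\<close>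
        have "distr (M N) borel (p N k) = distr (M N) lborel (p N k)"
          by (rule distr_cong) simp_all
        also have "\<dots> = D"
          using assms(10)[OF N k] by (simp only: distributed_def D_def)
        finally show ?thesis .
      qed
    qed (fact assms(9)[OF N], fact assms(7))
  qed
  define \<delta> where "\<delta> N = (\<integral>\<omega>. \<bar>sig_fraction L (\<lambda>k. p N k \<omega>) N s - log 10 s\<bar> \<partial>M N)" for N
  have \<delta>: "\<delta> \<longlonglongrightarrow> 0"
    unfolding \<delta>_def[abs_def] by (rule sig_fraction_L1_tendsto[OF sb s])
  have \<sigma>: "0 \<le> log 10 s" "log 10 s \<le> 1"
    using s by auto
  have "(\<lambda>N. (\<integral>\<omega>. sig_fraction L (\<lambda>k. p N k \<omega>) N s \<partial>M N) - log 10 s) \<longlonglongrightarrow> 0"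
  proof (rule Lim_null_comparison[OF _ \<delta>])
    show "\<forall>\<^sub>F N in sequentially. norm ((\<integral>\<omega>. sig_fraction L (\<lambda>k. p N k \<omega>) N s \<partial>M N) - log 10 s) \<le> \<delta> N"
      unfolding \<delta>_def real_norm_def
      by (intro eventually_sequentiallyI[of 1] stick_breaking.mean_variance_le_deviation(1)[OF sb \<sigma>])
  qed
  moreover have "(\<lambda>N. prob_space.variance (M N) (\<lambda>\<omega>. sig_fraction L (\<lambda>k. p N k \<omega>) N s)) \<longlonglongrightarrow> 0"
  proof (rule tendsto_sandwich[OF _ _ tendsto_const \<delta>])
    show "\<forall>\<^sub>F N in sequentially. prob_space.variance (M N) (\<lambda>\<omega>. sig_fraction L (\<lambda>k. p N k \<omega>) N s) \<le> \<delta> N"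
      unfolding \<delta>_def
      by (intro eventually_sequentiallyI[of 1] stick_breaking.mean_variance_le_deviation(2)[OF sb \<sigma>])
    show "\<forall>\<^sub>F N in sequentially. 0 \<le> prob_space.variance (M N) (\<lambda>\<omega>. sig_fraction L (\<lambda>k. p N k \<omega>) N s)"
      by (intro always_eventually allI Bochner_Integration.integral_nonneg zero_le_power2)
  qed
  ultimately show "(\<lambda>N. prob_space.expectation (M N) (\<lambda>\<omega>. sig_fraction L (\<lambda>k. p N k \<omega>) N s)) \<longlonglongrightarrow> log 10 s \<and>
      (\<lambda>N. prob_space.variance (M N) (\<lambda>\<omega>. sig_fraction L (\<lambda>k. p N k \<omega>) N s)) \<longlonglongrightarrow> 0"
    by (intro conjI) (rule LIM_zero_cancel)
qed

end
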